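(* Let $\Gamma(\mathbb{K})$ be either $\mathrm{Gr}_J(A_n(\mathbb{K}))$ for a division ring $\mathbb{K}$, or $\mathrm{Gr}_J(D_n(\mathbb{K}))$ for a field $\mathbb{K}$, where $J$ is a set of nodes of the diagram $A_n$ or $D_n$ respectively which is non-connected (the subgraph of the diagram induced on $J$ is not connected). Then $\Gamma(\mathbb{K})$ is not $\mathbb{K}_0$-generated for any proper sub-division ring $\mathbb{K}_0$ of $\mathbb{K}$.
   Context: Building $A_n(\mathbb{K})$: let $V$ be a right vector space of dimension $n+1$ over the division ring $\mathbb{K}$ with a fixed basis $E$. The elements of $A_n(\mathbb{K})$ are the subspaces of $V$ of dimension $1,\dots,n$ (type = dimension); incidence is symmetrized inclusion. The diagram $A_n$ is the path $1-2-\cdots-n$. Building $D_n(\mathbb{K})$ ($\mathbb{K}$ a field, $n\ge 3$): $V$ is $2n$-dimensional over $\mathbb{K}$ with basis $E=(e_1,\dots,e_{2n})$ and quadratic form $q=x_1x_2+\dots+x_{2n-1}x_{2n}$. The $n$-dimensional totally singular subspaces split into classes $\mathfrak S^+,\mathfrak S^-$ ($X,Y$ in the same class iff $X\cap Y$ has even codimension in $X$). Elements of $D_n(\mathbb{K})$: totally singular subspaces of dimension $i\in\{1,\dots,n-2\}$ (type $i$), and members of $\mathfrak S^+$ (type $+$) and $\mathfrak S^-$ (type $-$); incidence is symmetrized inclusion except that $X\in\mathfrak S^+$, $Y\in\mathfrak S^-$ are incident iff $\dim(X\cap Y)=n-1$. The diagram $D_n$ is the path $1-\cdots-(n-2)$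 with $n-2$ adjacent to both $+$ and $-$. A flag is a set of pairwise incident elements. For a nonempty type set $J$, $\mathrm{Gr}_J$ is the point-line geometry with points the flags of type $J$ and lines the flags of type $(J\setminus\{j\})\cup\mathrm{fr}(j)$, $j\in J$, where $\mathrm{fr}(j)$ is the set of diagram neighbours of $j$; incidence: the union is a flag. For a sub-division ring $\mathbb{K}_0$, a vector is $\mathbb{K}_0$-rational if it is a $\mathbb{K}_0$-combination of $E$; a subspace is $\mathbb{K}_0$-rational if it has a basis of $\mathbb{K}_0$-rational vectors; a flag is $\mathbb{K}_0$-rational if all its elements are. $\Gamma(\mathbb{K})$ is $\mathbb{K}_0$-generated if the smallest subspace (set of points containing every line meeting it in $\ge 2$ points) containing all $\mathbb{K}_0$-rational points is the whole point set. *)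

theory Defs
  imports Complex_Main
begin

section \<open>Right vector spaces over a division ring\<close>

text \<open>The library locales \<open>module\<close> and \<open>vector_space\<close> need commutative scalars, so the few notions
  of linear algebra used here are set up for right vector spaces over an arbitrary division ring.
  As in the library, the space is a whole type and only the scalar multiplication is a parameter;
  \<open>scale v a\<close> stands for \<open>v a\<close>.\<close>

locale right_vector_space =
  fixes scale :: "'v::ab_group_add \<Rightarrow> 'k::division_ring \<Rightarrow> 'v"
  assumes scale_add_left: "scale (v + w) a = scale v a + scale w a"
    and scale_add_right: "scale v (a + b) = scale v a + scale v b"
    and scale_scale: "scale (scale v a) b = scale v (a * b)"
    and scale_one: "scale v 1 = v"

definition combinations ::
    "('v::ab_group_add \<Rightarrow> 'k::division_ring \<Rightarrow> 'v) \<Rightarrow> 'k set \<Rightarrow> 'v set \<Rightarrow> 'v set" where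
  "combinations scale K B =
     {\<Sum>b\<in>S. scale b (c b) | S c. finite S \<and> S \<subseteq> B \<and> c ` S \<subseteq> K}"

definition rindependent ::
    "('v::ab_group_add \<Rightarrow> 'k::division_ring \<Rightarrow> 'v) \<Rightarrow> 'v set \<Rightarrow> bool" where
  "rindependent scale B \<longleftrightarrow>
     (\<forall>S c. finite S \<and> S \<subseteq> B \<and> (\<Sum>b\<in>S. scale b (c b)) = 0 \<longrightarrow> (\<forall>b\<in>S. c b = 0))"

definition rbasis ::
    "('v::ab_group_add \<Rightarrow> 'k::division_ring \<Rightarrow> 'v) \<Rightarrow> 'v set \<Rightarrow> 'v set \<Rightarrow> bool" where
  "rbasis scale B U \<longleftrightarrow> rindependent scale B \<and> combinations scale UNIV B = U"

definition rsubspace ::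
    "('v::ab_group_add \<Rightarrow> 'k::division_ring \<Rightarrow> 'v) \<Rightarrow> 'v set \<Rightarrow> bool" where
  "rsubspace scale U \<longleftrightarrow>
     0 \<in> U \<and> (\<forall>v\<in>U. \<forall>w\<in>U. v + w \<in> U) \<and> (\<forall>v\<in>U. \<forall>a. scale v a \<in> U)"

definition rdim ::
    "('v::ab_group_add \<Rightarrow> 'k::division_ring \<Rightarrow> 'v) \<Rightarrow> 'v set \<Rightarrow> nat" where
  "rdim scale U = card (SOME B. rbasis scale B U)"

text \<open>A right vector space of dimension \<open>m\<close> with a fixed basis \<open>E 1, \<dots>, E m\<close>.\<close>

locale based_right_vector_space = right_vector_space scale
  for scale :: "'v::ab_group_add \<Rightarrow> 'k::division_ring \<Rightarrow> 'v" +
  fixes m :: nat and E :: "nat \<Rightarrow> 'v"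
  assumes inj_E: "inj_on E {1..m}"
    and basis_E: "rbasis scale (E ` {1..m}) UNIV"

definition coords ::
    "('v::ab_group_add \<Rightarrow> 'k::division_ring \<Rightarrow> 'v) \<Rightarrow> nat \<Rightarrow> (nat \<Rightarrow> 'v) \<Rightarrow> 'v \<Rightarrow> nat \<Rightarrow> 'k" where
  "coords scale m E v =
     (THE x. (\<forall>i. i \<notin> {1..m} \<longrightarrow> x i = 0) \<and> v = (\<Sum>i=1..m. scale (E i) (x i)))"

section \<open>Rationality over a sub-division ring\<close>

definition sub_division_ring :: "'k::division_ring set \<Rightarrow> bool" where
  "sub_division_ring K \<longleftrightarrow>
     0 \<in> K \<and> 1 \<in> K \<and> (\<forall>a\<in>K. \<forall>b\<in>K. a - b \<in> K \<and> a * b \<in> K) \<and> (\<forall>a\<in>K. a \<noteq> 0 \<longrightarrow> inverse a \<in> K)"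

definition rational_vectors ::
    "('v::ab_group_add \<Rightarrow> 'k::division_ring \<Rightarrow> 'v) \<Rightarrow> nat \<Rightarrow> (nat \<Rightarrow> 'v) \<Rightarrow> 'k set \<Rightarrow> 'v set" where
  "rational_vectors scale m E K = combinations scale K (E ` {1..m})"

definition rational_subspace ::
    "('v::ab_group_add \<Rightarrow> 'k::division_ring \<Rightarrow> 'v) \<Rightarrow> nat \<Rightarrow> (nat \<Rightarrow> 'v) \<Rightarrow> 'k set \<Rightarrow> 'v set \<Rightarrow> bool" where
  "rational_subspace scale m E K U \<longleftrightarrow>
     (\<exists>B. rbasis scale B U \<and> B \<subseteq> rational_vectors scale m E K)"

definition rational_flag ::
    "('v::ab_group_add \<Rightarrow> 'k::division_ring \<Rightarrow> 'v) \<Rightarrow> nat \<Rightarrow> (nat \<Rightarrow> 'v) \<Rightarrow> 'k set \<Rightarrow> 'v set set \<Rightarrow> bool" where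
  "rational_flag scale m E K F \<longleftrightarrow> (\<forall>U\<in>F. rational_subspace scale m E K U)"

section \<open>Point-line geometries\<close>

record ('p, 'l) point_line_geometry =
  points :: "'p set"
  lines :: "'l set"
  on_line :: "'p \<Rightarrow> 'l \<Rightarrow> bool"

definition geo_subspace :: "('p, 'l) point_line_geometry \<Rightarrow> 'p set \<Rightarrow> bool" where
  "geo_subspace \<Gamma> S \<longleftrightarrow> S \<subseteq> points \<Gamma> \<and>
     (\<forall>l\<in>lines \<Gamma>. (\<exists>p\<in>S. \<exists>q\<in>S. p \<noteq> q \<and> on_line \<Gamma> p l \<and> on_line \<Gamma> q l)
        \<longrightarrow> {p \<in> points \<Gamma>. on_line \<Gamma> p l} \<subseteq> S)"

definition geo_span :: "('p, 'l) point_line_geometry \<Rightarrow> 'p set \<Rightarrow> 'p set" where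
  "geo_span \<Gamma> R = \<Inter> {S. geo_subspace \<Gamma> S \<and> R \<subseteq> S}"

section \<open>Geometries over a diagram and their Grassmannians\<close>

record ('e, 't) diagram_geometry =
  elements :: "'e set"
  type_of :: "'e \<Rightarrow> 't"
  incident :: "'e \<Rightarrow> 'e \<Rightarrow> bool"
  nodes :: "'t set"
  adjacent :: "'t \<Rightarrow> 't \<Rightarrow> bool"

definition flag :: "('e, 't) diagram_geometry \<Rightarrow> 'e set \<Rightarrow> bool" where
  "flag G F \<longleftrightarrow> F \<subseteq> elements G \<and> pairwise (incident G) F"

definition flags_of_type :: "('e, 't) diagram_geometry \<Rightarrow> 't set \<Rightarrow> 'e set set" where
  "flags_of_type G T = {F. flag G F \<and> type_of G ` F = T}"

definition fr :: "('e, 't) diagram_geometry \<Rightarrow> 't \<Rightarrow> 't set" where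
  "fr G j = {i \<in> nodes G. adjacent G j i}"

definition Gr :: "('e, 't) diagram_geometry \<Rightarrow> 't set \<Rightarrow> ('e set, 'e set) point_line_geometry" where
  "Gr G J =
     \<lparr> points = flags_of_type G J,
       lines = (\<Union>j\<in>J. flags_of_type G ((J - {j}) \<union> fr G j)),
       on_line = (\<lambda>p l. flag G (p \<union> l)) \<rparr>"

text \<open>The subgraph of the diagram induced on \<open>J\<close> is connected: any two nodes of \<open>J\<close> are joined
  by a path inside \<open>J\<close>. The empty set is connected in this sense.\<close>

definition connected_nodes :: "('e, 't) diagram_geometry \<Rightarrow> 't set \<Rightarrow> bool" where
  "connected_nodes G J \<longleftrightarrow>
     (\<forall>i\<in>J. \<forall>j\<in>J. (i, j) \<in> {(a, b). a \<in> J \<and> b \<in> J \<and> adjacent G a b}\<^sup>*)"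

definition rationally_generated ::
    "('v::ab_group_add \<Rightarrow> 'k::division_ring \<Rightarrow> 'v) \<Rightarrow> nat \<Rightarrow> (nat \<Rightarrow> 'v) \<Rightarrow> 'k set
      \<Rightarrow> ('v set set, 'l) point_line_geometry \<Rightarrow> bool" where
  "rationally_generated scale m E K \<Gamma> \<longleftrightarrow>
     geo_span \<Gamma> {p \<in> points \<Gamma>. rational_flag scale m E K p} = points \<Gamma>"

section \<open>The building of type \<open>A\<^sub>n\<close>\<close>

definition A_building ::
    "('v::ab_group_add \<Rightarrow> 'k::division_ring \<Rightarrow> 'v) \<Rightarrow> nat \<Rightarrow> ('v set, nat) diagram_geometry" where
  "A_building scale n =
     \<lparr> elements = {U. rsubspace scale U \<and> rdim scale U \<in> {1..n}},
       type_of = rdim scale,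
       incident = (\<lambda>X Y. X \<subseteq> Y \<or> Y \<subseteq> X),
       nodes = {1..n},
       adjacent = (\<lambda>i j. j = i + 1 \<or> i = j + 1) \<rparr>"

section \<open>The building of type \<open>D\<^sub>n\<close>\<close>

datatype D_node = Dim nat | Plus | Minus

definition quad_form ::
    "('v::ab_group_add \<Rightarrow> 'k::field \<Rightarrow> 'v) \<Rightarrow> nat \<Rightarrow> (nat \<Rightarrow> 'v) \<Rightarrow> 'v \<Rightarrow> 'k" where
  "quad_form scale n E v =
     (\<Sum>i=1..n. coords scale (2 * n) E v (2 * i - 1) * coords scale (2 * n) E v (2 * i))"

definition totally_singular ::
    "('v::ab_group_add \<Rightarrow> 'k::field \<Rightarrow> 'v) \<Rightarrow> nat \<Rightarrow> (nat \<Rightarrow> 'v) \<Rightarrow> 'v set \<Rightarrow> bool" where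
  "totally_singular scale n E U \<longleftrightarrow> rsubspace scale U \<and> (\<forall>v\<in>U. quad_form scale n E v = 0)"

definition max_singular ::
    "('v::ab_group_add \<Rightarrow> 'k::field \<Rightarrow> 'v) \<Rightarrow> nat \<Rightarrow> (nat \<Rightarrow> 'v) \<Rightarrow> 'v set set" where
  "max_singular scale n E = {X. totally_singular scale n E X \<and> rdim scale X = n}"

definition same_class ::
    "('v::ab_group_add \<Rightarrow> 'k::field \<Rightarrow> 'v) \<Rightarrow> 'v set \<Rightarrow> 'v set \<Rightarrow> bool" where
  "same_class scale X Y \<longleftrightarrow> even (rdim scale X - rdim scale (X \<inter> Y))"

text \<open>Which of the two classes is labelled \<open>+\<close> is a convention: here it is the class of
  the span of \<open>E 1, E 3, \<dots>, E (2 * n - 1)\<close>. The other choice interchanges \<^const>\<open>Plus\<close> and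
  \<^const>\<open>Minus\<close>, which is a symmetry of the diagram.\<close>

definition S_plus ::
    "('v::ab_group_add \<Rightarrow> 'k::field \<Rightarrow> 'v) \<Rightarrow> nat \<Rightarrow> (nat \<Rightarrow> 'v) \<Rightarrow> 'v set set" where
  "S_plus scale n E = {X \<in> max_singular scale n E.
     same_class scale X (combinations scale UNIV ((\<lambda>i. E (2 * i - 1)) ` {1..n}))}"

definition S_minus ::
    "('v::ab_group_add \<Rightarrow> 'k::field \<Rightarrow> 'v) \<Rightarrow> nat \<Rightarrow> (nat \<Rightarrow> 'v) \<Rightarrow> 'v set set" where
  "S_minus scale n E = max_singular scale n E - S_plus scale n E"

fun D_adjacent :: "nat \<Rightarrow> D_node \<Rightarrow> D_node \<Rightarrow> bool" where
  "D_adjacent n (Dim i) (Dim j) \<longleftrightarrow> j = i + 1 \<or> i = j + 1"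
| "D_adjacent n (Dim i) _ \<longleftrightarrow> i = n - 2"
| "D_adjacent n _ (Dim j) \<longleftrightarrow> j = n - 2"
| "D_adjacent n _ _ \<longleftrightarrow> False"

definition D_building ::
    "('v::ab_group_add \<Rightarrow> 'k::field \<Rightarrow> 'v) \<Rightarrow> nat \<Rightarrow> (nat \<Rightarrow> 'v) \<Rightarrow> ('v set, D_node) diagram_geometry" where
  "D_building scale n E =
     \<lparr> elements = {U. totally_singular scale n E U \<and> rdim scale U \<in> {1..n - 2}}
                    \<union> S_plus scale n E \<union> S_minus scale n E,
       type_of = (\<lambda>U. if U \<in> S_plus scale n E then Plus
                      else if U \<in> S_minus scale n E then Minus
                      else Dim (rdim scale U)),
       incident = (\<lambda>X Y.
          if X \<in> S_plus scale n E \<and> Y \<in> S_minus scale n E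
             \<or> X \<in> S_minus scale n E \<and> Y \<in> S_plus scale n E
          then rdim scale (X \<inter> Y) = n - 1
          else X \<subseteq> Y \<or> Y \<subseteq> X),
       nodes = Dim ` {1..n - 2} \<union> {Plus, Minus},
       adjacent = D_adjacent n \<rparr>"

end

theory Submission
  imports Defs "HOL-Library.Set_Algebras"
begin

text \<open>Two types \<open>s, t \<in> J\<close> already give a proper geometric subspace containing the rational flags: the
  flags \<open>F\<close> such that some rational subspace \<open>Z\<close> satisfies \<open>F\<^sub>s \<subseteq> Z \<subseteq> F\<^sub>t\<close>. If \<open>F\<^sub>s\<close> moves on a line, then
  any two of its positions span all the others, and the sum of the two rational subspaces serves for
  every point of the line; if \<open>F\<^sub>t\<close> moves, take the intersection. In type D the types \<open>+\<close> and \<open>-\<close>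
  are not comparable by inclusion; for them the condition is that \<open>F\<^sub>+\<close> or \<open>F\<^sub>-\<close> is rational or that
  \<open>F\<^sub>+ \<inter> F\<^sub>-\<close> contains a rational subspace of dimension at least \<open>n - 2\<close>.
  A chamber violating all these conditions is built around \<open>e\<^sub>1 + e\<^sub>2 a\<close> (type A) or the totally singular
  plane spanned by \<open>e\<^sub>1 + e\<^sub>3 a\<close> and \<open>e\<^sub>4 - e\<^sub>2 a\<close> (type D), where \<open>a\<close> is not in \<open>K\<^sub>0\<close>.\<close>

section \<open>Linear algebra over a division ring\<close>

text \<open>Sums of rational subspaces are visibly rational; intersections are not, and over a
  division ring this needs an argument without determinants: invariance under coordinatewise maps.
  Two positions of \<open>F_+\<close> on a line meet only in dimension \<open>n - 2\<close>, so a
  witness valid for all positions cannot be larger. If two different witnesses of that dimension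
  occur inside the same \<open>F_-\<close>, they generate a rational subspace of dimension at least
  \<open>n - 1\<close> there, and this makes \<open>F_-\<close> itself rational: a rational totally
  singular subspace of dimension \<open>n - 1\<close> lies in just two maximal ones, and both are
  rational. Admitting witnesses of dimension \<open>n - 2\<close> has a price in the chamber:
  \<open>F_+ \<inter> F_-\<close> has dimension \<open>n - 1\<close>, so missing a single irrational
  direction still leaves room for a witness, while missing a plane does not. Hence type D needs a
  plane where type A needs one vector.\<close>

context right_vector_space
begin

abbreviation rspan :: "'v set \<Rightarrow> 'v set" where
  "rspan \<equiv> combinations scale UNIV"

lemma scale_zero_left [simp]: "scale 0 a = 0"
  using scale_add_left[of 0 0 a] by simp

lemma scale_zero_right [simp]: "scale v 0 = 0"
  using scale_add_right[of v 0 0] by simp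

lemma scale_minus_left: "scale (- v) a = - scale v a"
  using scale_add_left[of v "- v" a] by (simp add: eq_neg_iff_add_eq_0 add.commute)

lemma scale_minus_right: "scale v (- a) = - scale v a"
  using scale_add_right[of v a "- a"] by (simp add: eq_neg_iff_add_eq_0 add.commute)

lemma scale_diff_left: "scale (v - w) a = scale v a - scale w a"
  using scale_add_left[of v "- w" a] by (simp add: scale_minus_left)

lemma scale_diff_right: "scale v (a - b) = scale v a - scale v b"
  using scale_add_right[of v a "- b"] by (simp add: scale_minus_right)

lemma scale_sum_left: "scale (\<Sum>i\<in>I. f i) a = (\<Sum>i\<in>I. scale (f i) a)"
  by (induction I rule: infinite_finite_induct) (auto simp: scale_add_left)

lemma scale_sum_right: "scale v (\<Sum>i\<in>I. c i) = (\<Sum>i\<in>I. scale v (c i))"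
  by (induction I rule: infinite_finite_induct) (auto simp: scale_add_right)

lemma rsubspaceD:
  assumes "rsubspace scale U"
  shows "0 \<in> U" "v \<in> U \<Longrightarrow> w \<in> U \<Longrightarrow> v + w \<in> U" "v \<in> U \<Longrightarrow> scale v a \<in> U"
    "v \<in> U \<Longrightarrow> - v \<in> U" "v \<in> U \<Longrightarrow> w \<in> U \<Longrightarrow> v - w \<in> U"
proof -
  show *: "0 \<in> U" "v \<in> U \<Longrightarrow> w \<in> U \<Longrightarrow> v + w \<in> U" "v \<in> U \<Longrightarrow> scale v a \<in> U" for v w a
    using assms by (auto simp: rsubspace_def)
  show **: "v \<in> U \<Longrightarrow> - v \<in> U" for v
    using *(3)[of v "- 1"] by (simp add: scale_minus_right scale_one)
  show "v \<in> U \<Longrightarrow> w \<in> U \<Longrightarrow> v - w \<in> U"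
    using *(2)[of v "- w"] ** by simp
qed

lemma rsubspace_sum:
  assumes "rsubspace scale U" "\<And>i. i \<in> I \<Longrightarrow> f i \<in> U"
  shows "(\<Sum>i\<in>I. f i) \<in> U"
  using assms(2) by (induction I rule: infinite_finite_induct) (auto intro: rsubspaceD[OF assms(1)])

lemma rsubspace_Int: "rsubspace scale U \<Longrightarrow> rsubspace scale W \<Longrightarrow> rsubspace scale (U \<inter> W)"
  by (auto simp: rsubspace_def)

lemma rsubspace_UNIV: "rsubspace scale UNIV"
  by (auto simp: rsubspace_def)

lemma rsubspace_zero: "rsubspace scale {0}"
  by (auto simp: rsubspace_def)

lemma rsubspace_plus:
  assumes "rsubspace scale U" "rsubspace scale W"
  shows "rsubspace scale (U + W)"
  unfolding rsubspace_def
proof (intro conjI ballI allI)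
  show "0 \<in> U + W"
    using set_plus_intro[OF rsubspaceD(1)[OF assms(1)] rsubspaceD(1)[OF assms(2)]] by simp
next
  fix v w assume "v \<in> U + W" "w \<in> U + W"
  then obtain u1 w1 u2 w2 where *: "v = u1 + w1" "w = u2 + w2" "u1 \<in> U" "u2 \<in> U" "w1 \<in> W" "w2 \<in> W"
    by (auto elim!: set_plus_elim)
  have "(u1 + u2) + (w1 + w2) \<in> U + W"
    using * assms by (intro set_plus_intro rsubspaceD) auto
  then show "v + w \<in> U + W" by (simp add: * algebra_simps)
next
  fix v a assume "v \<in> U + W"
  then obtain u w where "v = u + w" "u \<in> U" "w \<in> W" by (auto elim!: set_plus_elim)
  then show "scale v a \<in> U + W"
    using rsubspaceD(3)[OF assms(1)] rsubspaceD(3)[OF assms(2)]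
    by (simp add: scale_add_left set_plus_intro)
qed

lemma subset_plus_left: "rsubspace scale W \<Longrightarrow> U \<subseteq> U + W"
  using set_plus_intro[of _ U 0 W] rsubspaceD(1) by fastforce

lemma subset_plus_right: "rsubspace scale U \<Longrightarrow> W \<subseteq> U + W"
  using set_plus_intro[of 0 U _ W] rsubspaceD(1) by fastforce

lemma plus_least: "rsubspace scale X \<Longrightarrow> U \<subseteq> X \<Longrightarrow> W \<subseteq> X \<Longrightarrow> U + W \<subseteq> X"
  by (auto elim!: set_plus_elim intro: rsubspaceD)

lemma combinations_finite:
  assumes "finite B" "0 \<in> K"
  shows "combinations scale K B = {\<Sum>b\<in>B. scale b (c b) | c. c ` B \<subseteq> K}"
proof (intro equalityI subsetI)
  fix v assume "v \<in> combinations scale K B"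
  then obtain S c where S: "finite S" "S \<subseteq> B" "c ` S \<subseteq> K" "v = (\<Sum>b\<in>S. scale b (c b))"
    by (auto simp: combinations_def)
  let ?d = "\<lambda>b. if b \<in> S then c b else 0"
  have "v = (\<Sum>b\<in>B. scale b (?d b)) \<and> ?d ` B \<subseteq> K"
    unfolding S(4) using S assms by (intro conjI sum.mono_neutral_cong_left) auto
  then show "v \<in> {\<Sum>b\<in>B. scale b (c b) | c. c ` B \<subseteq> K}"
    unfolding mem_Collect_eq by (rule exI[where x = ?d])
next
  fix v assume "v \<in> {\<Sum>b\<in>B. scale b (c b) | c. c ` B \<subseteq> K}"
  then show "v \<in> combinations scale K B"
    using assms(1) unfolding combinations_def by blast
qed

lemma rspan_sumI: "finite S \<Longrightarrow> S \<subseteq> B \<Longrightarrow> (\<Sum>b\<in>S. scale b (c b)) \<in> rspan B"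
  unfolding combinations_def by blast

lemma rspan_superset: "B \<subseteq> rspan B"
proof
  fix b assume "b \<in> B"
  then show "b \<in> rspan B"
    using rspan_sumI[of "{b}" B "\<lambda>_. 1"] by (simp add: scale_one)
qed

lemma rspan_least: "rsubspace scale U \<Longrightarrow> B \<subseteq> U \<Longrightarrow> rspan B \<subseteq> U"
  by (auto simp: combinations_def intro!: rsubspace_sum rsubspaceD(3))

lemma rsubspace_rspan: "rsubspace scale (rspan B)"
  unfolding rsubspace_def
proof (intro conjI ballI allI)
  show "0 \<in> rspan B" using rspan_sumI[of "{}" B] by simp
next
  fix v w assume "v \<in> rspan B" "w \<in> rspan B"
  then obtain S c T d where *: "finite S" "S \<subseteq> B" "v = (\<Sum>b\<in>S. scale b (c b))"
      "finite T" "T \<subseteq> B" "w = (\<Sum>b\<in>T. scale b (d b))"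
    by (auto simp: combinations_def)
  have "v = (\<Sum>b\<in>S \<union> T. scale b (if b \<in> S then c b else 0))"
    unfolding *(3) using * by (intro sum.mono_neutral_cong_left) auto
  moreover have "w = (\<Sum>b\<in>S \<union> T. scale b (if b \<in> T then d b else 0))"
    unfolding *(6) using * by (intro sum.mono_neutral_cong_left) auto
  ultimately have "v + w =
      (\<Sum>b\<in>S \<union> T. scale b ((if b \<in> S then c b else 0) + (if b \<in> T then d b else 0)))"
    by (simp add: sum.distrib scale_add_right)
  also have "\<dots> \<in> rspan B" using * by (intro rspan_sumI) auto
  finally show "v + w \<in> rspan B" .
next
  fix v a assume "v \<in> rspan B"
  then obtain S c where *: "finite S" "S \<subseteq> B" "v = (\<Sum>b\<in>S. scale b (c b))"
    by (auto simp: combinations_def)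
  have "scale v a = (\<Sum>b\<in>S. scale b (c b * a))"
    unfolding *(3) by (simp add: scale_sum_left scale_scale)
  also have "\<dots> \<in> rspan B" using * by (intro rspan_sumI) auto
  finally show "scale v a \<in> rspan B" .
qed

lemma rspan_mono: "A \<subseteq> B \<Longrightarrow> rspan A \<subseteq> rspan B"
  by (rule rspan_least[OF rsubspace_rspan]) (use rspan_superset in blast)

lemma rspan_subspace: "rsubspace scale U \<Longrightarrow> rspan U = U"
  using rspan_least[of U U] rspan_superset[of U] by blast

lemma rspan_empty: "rspan {} = {0}"
  using rspan_least[OF rsubspace_zero, of "{}"] rsubspaceD(1)[OF rsubspace_rspan] by blast

lemma rspan_Un: "rspan (A \<union> B) = rspan A + rspan B"
proof (rule equalityI)
  show "rspan (A \<union> B) \<subseteq> rspan A + rspan B"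
    using rspan_superset[of A] rspan_superset[of B]
      subset_plus_left[OF rsubspace_rspan, of "rspan A" B]
      subset_plus_right[OF rsubspace_rspan, of "rspan B" A]
    by (intro rspan_least rsubspace_plus rsubspace_rspan) blast
  show "rspan A + rspan B \<subseteq> rspan (A \<union> B)"
    by (intro plus_least rsubspace_rspan rspan_mono) auto
qed

lemma rspan_singleton: "rspan {x} = range (scale x)"
  by (subst combinations_finite) auto

lemma rspan_insert: "v \<in> rspan (insert x B) \<longleftrightarrow> (\<exists>a. v - scale x a \<in> rspan B)"
proof -
  have "v \<in> rspan (insert x B) \<longleftrightarrow> v \<in> range (scale x) + rspan B"
    using rspan_Un[of "{x}" B] by (simp add: rspan_singleton)
  also have "\<dots> \<longleftrightarrow> (\<exists>a. v - scale x a \<in> rspan B)"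
  proof
    assume "v \<in> range (scale x) + rspan B"
    then obtain a w where "v = scale x a + w" "w \<in> rspan B" by (auto elim!: set_plus_elim)
    then have "v - scale x a \<in> rspan B" by simp
    then show "\<exists>a. v - scale x a \<in> rspan B" ..
  next
    assume "\<exists>a. v - scale x a \<in> rspan B"
    then obtain a where "v - scale x a \<in> rspan B" ..
    then have "scale x a + (v - scale x a) \<in> range (scale x) + rspan B"
      by (intro set_plus_intro) auto
    then show "v \<in> range (scale x) + rspan B" by simp
  qed
  finally show ?thesis .
qed

section \<open>Linear independence and the exchange lemma\<close>

lemma rindependentD:
  assumes "rindependent scale B" "finite S" "S \<subseteq> B" "(\<Sum>b\<in>S. scale b (c b)) = 0" "b \<in> S"
  shows "c b = 0"
  using assms(1)[unfolded rindependent_def, THEN spec[of _ S], THEN spec[of _ c]] assms(2-5) by simp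

lemma rindependent_finiteI:
  assumes "finite B" "\<And>c b. (\<Sum>b\<in>B. scale b (c b)) = 0 \<Longrightarrow> b \<in> B \<Longrightarrow> c b = 0"
  shows "rindependent scale B"
  unfolding rindependent_def
proof (intro allI impI ballI)
  fix S c b assume S: "finite S \<and> S \<subseteq> B \<and> (\<Sum>b\<in>S. scale b (c b)) = 0" "b \<in> S"
  have "(\<Sum>b\<in>S. scale b (c b)) = (\<Sum>b\<in>B. scale b (if b \<in> S then c b else 0))"
    using S assms(1) by (intro sum.mono_neutral_cong_left) auto
  then have "(if b \<in> S then c b else 0) = 0"
    using S by (intro assms(2)) auto
  then show "c b = 0" using S by simp
qed

lemma rindependent_empty: "rindependent scale {}"
  by (auto simp: rindependent_def)

lemma rindependent_insert:
  assumes "finite B" "rindependent scale B" "x \<notin> rspan B"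
  shows "rindependent scale (insert x B)"
proof -
  have x: "x \<notin> B" using assms rspan_superset by blast
  have "c b = 0" if "(\<Sum>b\<in>insert x B. scale b (c b)) = 0" "b \<in> insert x B" for c b
  proof -
    have *: "scale x (c x) + (\<Sum>b\<in>B. scale b (c b)) = 0"
      using that(1) x assms(1) by simp
    have "c x = 0"
    proof (rule ccontr)
      assume "c x \<noteq> 0"
      then have "x = scale (scale x (c x)) (inverse (c x))"
        by (simp add: scale_scale scale_one)
      also have "scale x (c x) = - (\<Sum>b\<in>B. scale b (c b))"
        using * by (simp add: eq_neg_iff_add_eq_0)
      finally have "x = scale (- (\<Sum>b\<in>B. scale b (c b))) (inverse (c x))" .
      moreover have "\<dots> \<in> rspan B"
        using rsubspace_rspan[of B] rspan_superset[of B]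
        by (intro rsubspaceD rsubspace_sum) auto
      ultimately show False using assms(3) by simp
    qed
    moreover have "\<forall>b\<in>B. c b = 0"
      using * \<open>c x = 0\<close> assms(1) by (intro ballI rindependentD[OF assms(2) assms(1) order_refl]) simp
    ultimately show ?thesis using that(2) by auto
  qed
  then show ?thesis using assms(1) by (intro rindependent_finiteI) auto
qed

text \<open>Gaussian elimination: if some \<open>f j\<close> involves the spanning vector
  \<open>s\<close>, it serves to clear \<open>s\<close> from all other members, and \<open>j\<close>
  and \<open>s\<close> are dropped together. Families instead of sets spare the check that the
  modified vectors stay distinct.\<close>

lemma steinitz:
  assumes "finite T" "finite I" "f ` I \<subseteq> rspan T"
    and "\<And>c. (\<Sum>i\<in>I. scale (f i) (c i)) = 0 \<Longrightarrow> \<forall>i\<in>I. c i = 0"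
  shows "card I \<le> card T"
  using assms
proof (induction T arbitrary: I f rule: finite_induct)
  case empty
  have "\<forall>i\<in>I. f i = 0" using empty.prems(2) by (auto simp: rspan_empty)
  then have "\<forall>i\<in>I. (1::'k) = 0" by (intro empty.prems(3)) auto
  then have "I = {}" by auto
  then show ?case by simp
next
  case (insert s T)
  have "\<forall>i\<in>I. \<exists>a. f i - scale s a \<in> rspan T"
    using insert.prems(2) by (auto simp: rspan_insert)
  then obtain a where a: "\<And>i. i \<in> I \<Longrightarrow> f i - scale s (a i) \<in> rspan T" by metis
  show ?case
  proof (cases "\<exists>j\<in>I. a j \<noteq> 0")
    case False
    then have "f ` I \<subseteq> rspan T" using a by force
    then have "card I \<le> card T" using insert.IH insert.prems by blast
    then show ?thesis using insert.hyps by simp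
  next
    case True
    then obtain j where j: "j \<in> I" "a j \<noteq> 0" by blast
    define g where "g i = f i - scale (f j) (inverse (a j) * a i)" for i
    have "card (I - {j}) \<le> card T"
    proof (rule insert.IH)
      show "finite (I - {j})" using insert.prems by simp
      show "g ` (I - {j}) \<subseteq> rspan T"
      proof (rule image_subsetI)
        fix i assume "i \<in> I - {j}"
        then have "(f i - scale s (a i)) - scale (f j - scale s (a j)) (inverse (a j) * a i) \<in> rspan T"
          using j by (intro rsubspaceD(5)[OF rsubspace_rspan a rsubspaceD(3)[OF rsubspace_rspan a]]) auto
        also have "(f i - scale s (a i)) - scale (f j - scale s (a j)) (inverse (a j) * a i) = g i"
          using j by (simp add: g_def scale_diff_left scale_scale mult.assoc[symmetric])
        finally show "g i \<in> rspan T" .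
      qed
      fix c assume c: "(\<Sum>i\<in>I - {j}. scale (g i) (c i)) = 0"
      \<comment> \<open>\<open>d\<close> collects what the substitution \<open>g\<close> takes from
        \<open>f j\<close>, turning a relation among the \<open>g i\<close> into one among the
        \<open>f i\<close>.\<close>
      define d where "d = - (\<Sum>i\<in>I - {j}. inverse (a j) * a i * c i)"
      have "(\<Sum>i\<in>I. scale (f i) ((c(j := d)) i))
          = scale (f j) d + (\<Sum>i\<in>I - {j}. scale (f i) (c i))"
        using j insert.prems(1) by (subst sum.remove[of _ j]) auto
      also have "\<dots> = (\<Sum>i\<in>I - {j}. scale (g i) (c i))"
        by (simp add: g_def d_def scale_diff_left sum_subtractf scale_scale scale_minus_right
            scale_sum_right)
      finally have "\<forall>i\<in>I. (c(j := d)) i = 0"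
        using c by (intro insert.prems(3)) simp
      then show "\<forall>i\<in>I - {j}. c i = 0" by (metis DiffE fun_upd_other insertI1)
    qed
    moreover have "card I = Suc (card (I - {j}))"
      using j(1) insert.prems(1) by (metis card.remove)
    ultimately show ?thesis using insert.hyps by simp
  qed
qed

end

section \<open>Bases and dimension of subspaces\<close>

context based_right_vector_space
begin

lemma rspan_E: "rspan (E ` {1..m}) = UNIV"
  using basis_E by (simp add: rbasis_def)

lemma rindependent_card:
  assumes "rindependent scale B"
  shows "finite B \<and> card B \<le> m"
proof -
  have *: "card A \<le> m" if "finite A" "A \<subseteq> B" for A
  proof -
    have "card A \<le> card (E ` {1..m})"
      using that(1) rspan_E
      by (intro steinitz[where f = "\<lambda>x. x"] ballI rindependentD[OF assms that]) auto
    then show ?thesis using card_image_le[of "{1..m}" E] by simp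
  qed
  have "finite B"
  proof (rule ccontr)
    assume "infinite B"
    then obtain A where "A \<subseteq> B" "finite A" "card A = Suc m"
      using infinite_arbitrarily_large by blast
    then show False using *[of A] by simp
  qed
  then show ?thesis using * by blast
qed

text \<open>Cardinalities of independent sets are bounded by \<open>m\<close>, so among those
  between \<open>A\<close> and \<open>U\<close> one of largest cardinality exists; a vector of
  \<open>U\<close> outside its span could still be adjoined.\<close>

lemma rbasis_extend:
  assumes "rsubspace scale U" "rindependent scale A" "A \<subseteq> U"
  obtains B where "A \<subseteq> B" "rbasis scale B U" "finite B"
proof -
  let ?P = "\<lambda>B. rindependent scale B \<and> A \<subseteq> B \<and> B \<subseteq> U"
  have "\<exists>B. ?P B \<and> (\<forall>C. ?P C \<longrightarrow> card C \<le> card B)"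
    using assms rindependent_card
    by (intro ex_has_greatest_nat[where k = A and b = "Suc m"]) (auto simp: less_Suc_eq_le)
  then obtain B where B: "?P B" "\<And>C. ?P C \<Longrightarrow> card C \<le> card B" by blast
  have fin: "finite B" using B rindependent_card by blast
  have "U \<subseteq> rspan B"
  proof
    fix x assume x: "x \<in> U"
    show "x \<in> rspan B"
    proof (rule ccontr)
      assume nx: "x \<notin> rspan B"
      then have "?P (insert x B)" using rindependent_insert[OF fin _ nx] B(1) x by auto
      then have "card (insert x B) \<le> card B" by (rule B(2))
      moreover have "x \<notin> B" using nx rspan_superset by blast
      ultimately show False using fin by simp
    qed
  qed
  moreover have "rspan B \<subseteq> U" using B(1) assms(1) rspan_least by blast
  ultimately show ?thesis using that[of B] B(1) fin by (auto simp: rbasis_def)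
qed

lemma rbasis_card_eq:
  assumes "rbasis scale A U" "rbasis scale B U"
  shows "card A = card B"
proof -
  have *: "card A \<le> card B" if "rbasis scale A U" "rbasis scale B U" for A B
    using that rindependent_card rspan_superset[of A]
    by (intro steinitz[where f = "\<lambda>x. x"] ballI rindependentD[of A A]) (auto simp: rbasis_def)
  show ?thesis using *[OF assms] *[OF assms(2,1)] by simp
qed

text \<open>Frees \<open>rdim\<close> from the arbitrary choice of a basis in its
  definition.\<close>

lemma rdim_eq_card:
  assumes "rbasis scale B U"
  shows "rdim scale U = card B"
  unfolding rdim_def using rbasis_card_eq[OF _ assms] someI[of "\<lambda>B. rbasis scale B U", OF assms] by blast

lemma obtain_rbasis:
  assumes "rsubspace scale U"
  obtains B where "rbasis scale B U" "finite B" "card B = rdim scale U"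
proof -
  obtain B where "rbasis scale B U" "finite B"
    using rbasis_extend[OF assms rindependent_empty] by blast
  then show ?thesis using that rdim_eq_card by metis
qed

lemma rdim_mono:
  assumes "rsubspace scale U" "rsubspace scale W" "U \<subseteq> W"
  shows "rdim scale U \<le> rdim scale W"
proof -
  obtain A where A: "rbasis scale A U" "finite A" "card A = rdim scale U"
    using obtain_rbasis[OF assms(1)] .
  have "rindependent scale A" "A \<subseteq> W"
    using A(1) rspan_superset[of A] assms(3) by (auto simp: rbasis_def)
  then obtain B where "A \<subseteq> B" "rbasis scale B W" "finite B"
    using rbasis_extend[OF assms(2)] by blast
  then show ?thesis using A(3) rdim_eq_card[of B W] card_mono[of B A] by simp
qed

lemma rsubspace_eqI:
  assumes "rsubspace scale U" "rsubspace scale W" "U \<subseteq> W" "rdim scale W \<le> rdim scale U"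
  shows "U = W"
proof -
  obtain A where A: "rbasis scale A U" "finite A" "card A = rdim scale U"
    using obtain_rbasis[OF assms(1)] .
  have "rindependent scale A" "A \<subseteq> W"
    using A(1) rspan_superset[of A] assms(3) by (auto simp: rbasis_def)
  then obtain B where B: "A \<subseteq> B" "rbasis scale B W" "finite B"
    using rbasis_extend[OF assms(2)] by blast
  then have "A = B" using A assms(4) rdim_eq_card[OF B(2)] by (intro card_seteq) auto
  then show ?thesis using A B by (simp add: rbasis_def)
qed

lemma rdim_strict_mono:
  "rsubspace scale U \<Longrightarrow> rsubspace scale W \<Longrightarrow> U \<subset> W \<Longrightarrow> rdim scale U < rdim scale W"
  using rsubspace_eqI[of U W] by force

lemma rdim_UNIV: "rdim scale UNIV = m"
  using rdim_eq_card[OF basis_E] card_image[OF inj_E] by simp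

lemma rdim_zero: "rdim scale {0} = 0"
  using rdim_eq_card[of "{}" "{0}"] by (simp add: rbasis_def rindependent_empty rspan_empty)

text \<open>A basis \<open>C\<close> of the intersection is extended to bases \<open>A\<close> of
  \<open>U\<close> and \<open>B\<close> of \<open>W\<close>; then \<open>A \<union> (B - C)\<close>
  is a basis of the sum. In a relation, the part over \<open>B - C\<close> lies in both spaces,
  hence in the span of \<open>C\<close>, and independence of \<open>B\<close> makes it
  vanish.\<close>

lemma rdim_plus_Int:
  assumes "rsubspace scale U" "rsubspace scale W"
  shows "rdim scale (U + W) + rdim scale (U \<inter> W) = rdim scale U + rdim scale W"
proof -
  obtain C where C: "rbasis scale C (U \<inter> W)" "finite C"
    using obtain_rbasis[OF rsubspace_Int[OF assms]] by blast
  have "C \<subseteq> U \<inter> W" "rindependent scale C"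
    using C(1) rspan_superset[of C] by (auto simp: rbasis_def)
  then have C': "C \<subseteq> U" "C \<subseteq> W" "rindependent scale C" by auto
  obtain A where A: "C \<subseteq> A" "rbasis scale A U" "finite A"
    using rbasis_extend[OF assms(1) C'(3,1)] by blast
  obtain B where B: "C \<subseteq> B" "rbasis scale B W" "finite B"
    using rbasis_extend[OF assms(2) C'(3,2)] by blast
  have indA: "rindependent scale A" and indB: "rindependent scale B"
    and spA: "rspan A = U" and spB: "rspan B = W" and spC: "rspan C = U \<inter> W"
    using A B C by (auto simp: rbasis_def)
  \<comment> \<open>Two coefficient functions are used because \<open>A\<close> and
    \<open>B - C\<close> are not yet known to be disjoint. Disjointness follows from this very fact:
    a common \<open>x\<close> would give the relation \<open>x - x = 0\<close>.\<close>
  have *: "c b = 0"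
    if c: "(\<Sum>b\<in>A. scale b (c b)) + (\<Sum>b\<in>B - C. scale b (d b)) = 0" "b \<in> A" for c d b
  proof -
    let ?y = "\<Sum>b\<in>B - C. scale b (d b)"
    have "?y \<in> W" unfolding spB[symmetric] using rspan_superset[of B]
      by (intro rsubspace_sum rsubspaceD(3) rsubspace_rspan) auto
    moreover have "(\<Sum>b\<in>A. scale b (c b)) \<in> U" unfolding spA[symmetric] using rspan_superset[of A]
      by (intro rsubspace_sum rsubspaceD(3) rsubspace_rspan) auto
    moreover have y: "?y = - (\<Sum>b\<in>A. scale b (c b))"
      using c(1) by (simp add: eq_neg_iff_add_eq_0 add.commute)
    ultimately have "?y \<in> rspan C" unfolding spC using rsubspaceD(4)[OF assms(1)] by auto
    then obtain e where e: "?y = (\<Sum>b\<in>C. scale b (e b))"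
      by (auto simp: combinations_finite[OF C(2)])
    have "(\<Sum>b\<in>B. scale b (if b \<in> C then - e b else d b))
        = (\<Sum>b\<in>B - C. scale b (d b)) + (\<Sum>b\<in>C. scale b (- e b))"
      using B by (subst sum.subset_diff[of C]) (auto intro!: arg_cong2[where f = "(+)"] sum.cong)
    also have "\<dots> = 0" by (simp add: e scale_minus_right sum_negf)
    finally have "\<forall>b\<in>B. (if b \<in> C then - e b else d b) = 0"
      by (intro ballI rindependentD[OF indB B(3) order_refl])
    then have "?y = 0" by (intro sum.neutral) (auto split: if_splits)
    then have "(\<Sum>b\<in>A. scale b (c b)) = 0" using y by simp
    then show "c b = 0" using rindependentD[OF indA A(3) order_refl _ c(2)] by blast
  qed
  have disj: "A \<inter> (B - C) = {}"
  proof (rule ccontr)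
    assume "A \<inter> (B - C) \<noteq> {}"
    then obtain x where x: "x \<in> A" "x \<in> B" "x \<notin> C" by blast
    have "(\<Sum>b\<in>A. scale b (if b = x then 1 else 0)) = (\<Sum>b\<in>A. if b = x then x else 0)"
      by (intro sum.cong) (auto simp: scale_one)
    then have 1: "(\<Sum>b\<in>A. scale b (if b = x then 1 else 0)) = x" using x A by simp
    have "(\<Sum>b\<in>B - C. scale b (if b = x then - 1 else 0)) = (\<Sum>b\<in>B - C. if b = x then - x else 0)"
      by (intro sum.cong) (auto simp: scale_one scale_minus_right)
    then have 2: "(\<Sum>b\<in>B - C. scale b (if b = x then - 1 else 0)) = - x" using x B by simp
    show False using *[of "\<lambda>b. if b = x then 1 else 0" "\<lambda>b. if b = x then - 1 else 0" x] 1 2 x by simp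
  qed
  have "c b = 0" if c: "(\<Sum>b\<in>A \<union> (B - C). scale b (c b)) = 0" "b \<in> A \<union> (B - C)" for c b
  proof -
    have eq: "(\<Sum>b\<in>A. scale b (c b)) + (\<Sum>b\<in>B - C. scale b (c b)) = 0"
      using c(1) A B disj by (simp add: sum.union_disjoint)
    then have "\<forall>b\<in>A. c b = 0" using *[of c c] by blast
    moreover from this eq have "(\<Sum>b\<in>B - C. scale b (c b)) = 0" by simp
    then have "\<forall>b\<in>B - C. c b = 0"
      using B(3) by (intro ballI rindependentD[OF indB, of "B - C"]) auto
    ultimately show ?thesis using c(2) by blast
  qed
  then have "rindependent scale (A \<union> (B - C))"
    using A B by (intro rindependent_finiteI) auto
  moreover have "rspan (A \<union> (B - C)) = U + W"
  proof -
    have "A \<union> (B - C) = A \<union> B" using A(1) by blast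
    then show ?thesis using rspan_Un[of A B] spA spB by simp
  qed
  ultimately have "rdim scale (U + W) = card (A \<union> (B - C))"
    by (intro rdim_eq_card) (simp add: rbasis_def)
  also have "\<dots> = card A + (card B - card C)"
    using A B C disj by (subst card_Un_disjoint) (auto simp: card_Diff_subset)
  finally show ?thesis
    using rdim_eq_card[OF A(2)] rdim_eq_card[OF B(2)] rdim_eq_card[OF C(1)] card_mono[OF B(3,1)] by simp
qed

lemma rdim_plus_le:
  assumes "rsubspace scale U"
  shows "rdim scale (U + rspan {x}) \<le> rdim scale U + 1"
proof -
  have "rdim scale (rspan {x}) \<le> 1"
  proof -
    obtain B where B: "rbasis scale B (rspan {x})" "finite B" "card B = rdim scale (rspan {x})"
      using obtain_rbasis[OF rsubspace_rspan] .
    then have "card B \<le> card {x}"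
      using rspan_superset[of B]
      by (intro steinitz[where f = "\<lambda>x. x"] ballI rindependentD[of B B]) (auto simp: rbasis_def)
    then show ?thesis using B by simp
  qed
  then show ?thesis using rdim_plus_Int[OF assms rsubspace_rspan[of "{x}"]] by simp
qed

lemma rdim_plus_singleton:
  assumes "rsubspace scale U" "x \<notin> U"
  shows "rdim scale (U + rspan {x}) = rdim scale U + 1"
proof -
  have "x \<in> U + rspan {x}"
    using subset_plus_right[OF assms(1), of "rspan {x}"] rspan_superset[of "{x}"] by blast
  then have "U \<subset> U + rspan {x}"
    using subset_plus_left[OF rsubspace_rspan] assms(2) by blast
  then have "rdim scale U < rdim scale (U + rspan {x})"
    using rdim_strict_mono assms(1) rsubspace_plus rsubspace_rspan by blast
  then show ?thesis using rdim_plus_le[OF assms(1), of x] by simp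
qed

end

section \<open>Coordinates and pivots\<close>

context based_right_vector_space
begin

abbreviation coord :: "'v \<Rightarrow> nat \<Rightarrow> 'k" where
  "coord \<equiv> coords scale m E"

text \<open>Justifies the definite description in \<open>coords\<close>; prescribing the value 0
  outside \<open>{1..m}\<close> is what makes the function unique.\<close>

lemma ex1_coords: "\<exists>!x. (\<forall>i. i \<notin> {1..m} \<longrightarrow> x i = 0) \<and> v = (\<Sum>i=1..m. scale (E i) (x i))"
proof -
  have "v \<in> rspan (E ` {1..m})" using rspan_E by simp
  then obtain c where c: "v = (\<Sum>b\<in>E ` {1..m}. scale b (c b))"
    by (auto simp: combinations_finite)
  have "v = (\<Sum>i=1..m. scale (E i) (if i \<in> {1..m} then c (E i) else 0))"
    unfolding c sum.reindex[OF inj_E] by (intro sum.cong) auto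
  then have ex: "\<exists>x. (\<forall>i. i \<notin> {1..m} \<longrightarrow> x i = 0) \<and> v = (\<Sum>i=1..m. scale (E i) (x i))"
    by (intro exI[of _ "\<lambda>i. if i \<in> {1..m} then c (E i) else 0"]) auto
  have "x = y" if
    x: "\<forall>i. i \<notin> {1..m} \<longrightarrow> x i = 0" "v = (\<Sum>i=1..m. scale (E i) (x i))" and
    y: "\<forall>i. i \<notin> {1..m} \<longrightarrow> y i = 0" "v = (\<Sum>i=1..m. scale (E i) (y i))" for x y
  proof
    fix i
    \<comment> \<open>Independence speaks about a set of vectors, so the difference of the two
      coordinate functions is transported from indices to basis vectors.\<close>
    define c where "c b = x (inv_into {1..m} E b) - y (inv_into {1..m} E b)" for b
    have cE: "c (E j) = x j - y j" if "j \<in> {1..m}" for j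
      using inv_into_f_f[OF inj_E that] by (simp add: c_def)
    have "(\<Sum>b\<in>E ` {1..m}. scale b (c b)) = (\<Sum>j=1..m. scale (E j) (x j - y j))"
      unfolding sum.reindex[OF inj_E] using cE by (intro sum.cong) auto
    also have "\<dots> = 0" using x(2) y(2) by (simp add: scale_diff_right sum_subtractf)
    finally have *: "c b = 0" if "b \<in> E ` {1..m}" for b
      using basis_E that unfolding rbasis_def
      by (intro rindependentD[of "E ` {1..m}" "E ` {1..m}"]) auto
    show "x i = y i"
    proof (cases "i \<in> {1..m}")
      case True
      then show ?thesis using *[of "E i"] cE by simp
    qed (use x(1) y(1) in simp)
  qed
  then show ?thesis using ex by blast
qed

lemma coords_outside: "i \<notin> {1..m} \<Longrightarrow> coord v i = 0"
  and coords_sum: "v = (\<Sum>i=1..m. scale (E i) (coord v i))"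
  using theI'[OF ex1_coords[of v]] unfolding coords_def by blast+

lemma coords_sum_scale:
  assumes "i \<in> {1..m}"
  shows "coord (\<Sum>i=1..m. scale (E i) (x i)) i = x i"
proof -
  let ?v = "\<Sum>i=1..m. scale (E i) (x i)"
  have "coord ?v = (\<lambda>i. if i \<in> {1..m} then x i else 0)"
    unfolding coords_def
    by (rule the1_equality[OF ex1_coords]) (auto intro!: sum.cong)
  then show ?thesis using assms by simp
qed

lemma coords_add: "coord (v + w) i = coord v i + coord w i"
proof (cases "i \<in> {1..m}")
  case True
  have "v + w = (\<Sum>i=1..m. scale (E i) (coord v i + coord w i))"
    by (subst (1) coords_sum[of v], subst (1) coords_sum[of w]) (simp only: scale_add_right sum.distrib)
  then show ?thesis using coords_sum_scale[OF True, of "\<lambda>i. coord v i + coord w i"] by simp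
qed (simp add: coords_outside)

lemma coords_scale: "coord (scale v a) i = coord v i * a"
proof (cases "i \<in> {1..m}")
  case True
  have "scale v a = (\<Sum>i=1..m. scale (E i) (coord v i * a))"
    by (subst (1) coords_sum[of v]) (simp only: scale_sum_left scale_scale)
  then show ?thesis using coords_sum_scale[OF True, of "\<lambda>i. coord v i * a"] by simp
qed (simp add: coords_outside)

lemma coords_zero [simp]: "coord 0 i = 0"
  using coords_scale[of 0 0 i] by simp

lemma coords_minus: "coord (- v) i = - coord v i"
  using coords_add[of v "- v" i] by (simp add: eq_neg_iff_add_eq_0 add.commute)

lemma coords_diff: "coord (v - w) i = coord v i - coord w i"
  using coords_add[of v "- w" i] by (simp add: coords_minus)

lemma coords_sum_distrib: "coord (\<Sum>j\<in>J. f j) i = (\<Sum>j\<in>J. coord (f j) i)"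
  by (induction J rule: infinite_finite_induct) (auto simp: coords_add)

lemma coords_E: "j \<in> {1..m} \<Longrightarrow> coord (E j) i = (if i = j then 1 else 0)"
proof (cases "i \<in> {1..m}")
  case True
  assume "j \<in> {1..m}"
  have "(\<Sum>i=1..m. scale (E i) (if i = j then 1 else 0)) = (\<Sum>i=1..m. if i = j then E i else 0)"
    by (intro sum.cong) (auto simp: scale_one)
  also have "\<dots> = E j" using \<open>j \<in> {1..m}\<close> by simp
  finally show ?thesis using coords_sum_scale[OF True, of "\<lambda>i. if i = j then 1 else 0"] by simp
qed (auto simp: coords_outside)

lemmas coords_simps = coords_add coords_scale coords_minus coords_diff coords_E

lemma eq_zero_coords: "(\<And>i. i \<in> {1..m} \<Longrightarrow> coord v i = 0) \<Longrightarrow> v = 0"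
  by (subst coords_sum) simp

lemma pivot_coeffs:
  assumes "finite I" "\<And>i j. i \<in> I \<Longrightarrow> j \<in> I \<Longrightarrow> coord (f i) (p j) = (if i = j then 1 else 0)" "j \<in> I"
  shows "coord (\<Sum>i\<in>I. scale (f i) (c i)) (p j) = c j"
proof -
  have "coord (\<Sum>i\<in>I. scale (f i) (c i)) (p j) = (\<Sum>i\<in>I. if i = j then c i else 0)"
    unfolding coords_sum_distrib using assms by (intro sum.cong) (auto simp: coords_scale)
  then show ?thesis using assms by simp
qed

text \<open>Echelon form: \<open>p\<close> picks a pivot coordinate for each member of the family \<open>f\<close>.\<close>

lemma rdim_pivots:
  assumes "finite I" "\<And>i j. i \<in> I \<Longrightarrow> j \<in> I \<Longrightarrow> coord (f i) (p j) = (if i = j then 1 else 0)"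
  shows "rdim scale (rspan (f ` I)) = card I"
proof -
  have inj: "inj_on f I"
  proof (rule inj_onI)
    fix i j assume ij: "i \<in> I" "j \<in> I" "f i = f j"
    then show "i = j" using assms(2)[of i j] assms(2)[of j j] by (simp split: if_splits)
  qed
  have "c b = 0" if "(\<Sum>b\<in>f ` I. scale b (c b)) = 0" "b \<in> f ` I" for c b
  proof -
    obtain j where j: "j \<in> I" "b = f j" using \<open>b \<in> f ` I\<close> by blast
    have "(\<Sum>i\<in>I. scale (f i) (c (f i))) = 0"
      using that(1) by (simp add: sum.reindex[OF inj])
    then show ?thesis using pivot_coeffs[OF assms j(1), of "\<lambda>i. c (f i)"] j by simp
  qed
  then have "rbasis scale (f ` I) (rspan (f ` I))"
    using assms(1) by (auto simp: rbasis_def intro: rindependent_finiteI)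
  then show ?thesis using rdim_eq_card card_image[OF inj] by simp
qed

end

section \<open>Rational subspaces\<close>

text \<open>Functions that are additive and homogeneous for left multiplication by \<open>K\<close> act coordinatewise;
  a subspace is rational if and only if it is invariant under all of them, which makes the
  intersection of rational subspaces rational.\<close>

definition left_linear :: "'k::division_ring set \<Rightarrow> ('k \<Rightarrow> 'k) \<Rightarrow> bool" where
  "left_linear K \<phi> \<longleftrightarrow> (\<forall>x y. \<phi> (x + y) = \<phi> x + \<phi> y) \<and> (\<forall>k\<in>K. \<forall>x. \<phi> (k * x) = k * \<phi> x)"

lemma sub_division_ringD:
  assumes "sub_division_ring K"
  shows "0 \<in> K" "1 \<in> K" "a \<in> K \<Longrightarrow> b \<in> K \<Longrightarrow> a - b \<in> K" "a \<in> K \<Longrightarrow> b \<in> K \<Longrightarrow> a * b \<in> K"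
    "a \<in> K \<Longrightarrow> inverse a \<in> K" "a \<in> K \<Longrightarrow> - a \<in> K" "a \<in> K \<Longrightarrow> b \<in> K \<Longrightarrow> a + b \<in> K"
proof -
  show *: "0 \<in> K" "1 \<in> K" "a \<in> K \<Longrightarrow> b \<in> K \<Longrightarrow> a - b \<in> K" "a \<in> K \<Longrightarrow> b \<in> K \<Longrightarrow> a * b \<in> K" for a b
    using assms by (auto simp: sub_division_ring_def)
  show "a \<in> K \<Longrightarrow> inverse a \<in> K" using assms by (cases "a = 0") (auto simp: sub_division_ring_def)
  show **: "a \<in> K \<Longrightarrow> - a \<in> K" for a using *(3)[of 0 a] *(1) by simp
  show "a \<in> K \<Longrightarrow> b \<in> K \<Longrightarrow> a + b \<in> K" using *(3)[of a "- b"] **[of b] by simp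
qed

lemma sub_division_ring_sum:
  "sub_division_ring K \<Longrightarrow> (\<And>i. i \<in> I \<Longrightarrow> f i \<in> K) \<Longrightarrow> (\<Sum>i\<in>I. f i) \<in> K"
  by (induction I rule: infinite_finite_induct) (auto intro: sub_division_ringD)

text \<open>The ring is a left vector space over \<open>K\<close>. A left subspace \<open>H\<close>
  that is maximal among those containing \<open>K\<close> and missing \<open>a\<close> is a
  complement of the line \<open>K a\<close>, and \<open>\<phi>\<close> reads off the coefficient of
  \<open>a\<close> modulo \<open>H\<close>. Since 1 lies in \<open>H\<close>, \<open>\<phi>\<close>
  vanishes there.\<close>

lemma ex_left_linear_functional:
  assumes K: "sub_division_ring K" and a: "a \<notin> K"
  obtains \<phi> where "left_linear K \<phi>" "\<phi> 1 = 0" "\<phi> a = 1" "range \<phi> \<subseteq> K"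
proof -
  define lsub where "lsub H \<longleftrightarrow> K \<subseteq> H \<and> (\<forall>x\<in>H. \<forall>y\<in>H. x + y \<in> H) \<and> (\<forall>k\<in>K. \<forall>x\<in>H. k * x \<in> H)" for H
  have "\<exists>M\<in>{H. lsub H \<and> a \<notin> H}. \<forall>X\<in>{H. lsub H \<and> a \<notin> H}. M \<subseteq> X \<longrightarrow> X = M"
  proof (rule subset_Zorn_nonempty)
    show "{H. lsub H \<and> a \<notin> H} \<noteq> {}"
      using a sub_division_ringD[OF K] by (auto simp: lsub_def intro!: exI[of _ K])
  next
    fix \<C> assume C: "\<C> \<noteq> {}" "subset.chain {H. lsub H \<and> a \<notin> H} \<C>"
    have mem: "\<And>H. H \<in> \<C> \<Longrightarrow> lsub H \<and> a \<notin> H" and tot: "\<And>X Y. X \<in> \<C> \<Longrightarrow> Y \<in> \<C> \<Longrightarrow> X \<subseteq> Y \<or> Y \<subseteq> X"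
      using C(2) by (auto simp: subset_chain_def)
    have "x + y \<in> \<Union>\<C>" if xy: "x \<in> \<Union>\<C>" "y \<in> \<Union>\<C>" for x y
    proof -
      obtain X Y where "X \<in> \<C>" "Y \<in> \<C>" "x \<in> X" "y \<in> Y" using xy by blast
      then obtain Z where "Z \<in> \<C>" "x \<in> Z" "y \<in> Z" using tot[of X Y] by blast
      then show ?thesis using mem[of Z] by (auto simp: lsub_def)
    qed
    moreover have "K \<subseteq> \<Union>\<C>" using C(1) mem by (fastforce simp: lsub_def)
    moreover have "\<forall>k\<in>K. \<forall>x\<in>\<Union>\<C>. k * x \<in> \<Union>\<C>" using mem by (fastforce simp: lsub_def)
    moreover have "a \<notin> \<Union>\<C>" using mem by blast
    ultimately show "\<Union>\<C> \<in> {H. lsub H \<and> a \<notin> H}" by (simp add: lsub_def)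
  qed
  then obtain H where H: "lsub H" "a \<notin> H" and max: "\<And>X. lsub X \<Longrightarrow> a \<notin> X \<Longrightarrow> H \<subseteq> X \<Longrightarrow> X = H"
    by blast
  have H_K: "K \<subseteq> H" and H_add: "\<And>x y. x \<in> H \<Longrightarrow> y \<in> H \<Longrightarrow> x + y \<in> H"
    and H_mult: "\<And>k x. k \<in> K \<Longrightarrow> x \<in> H \<Longrightarrow> k * x \<in> H"
    using H(1) by (auto simp: lsub_def)
  have H_minus: "- x \<in> H" if "x \<in> H" for x
    using H_mult[OF sub_division_ringD(6)[OF K sub_division_ringD(2)[OF K]] that] by simp
  have H_diff: "x - y \<in> H" if "x \<in> H" "y \<in> H" for x y
    using H_add[OF that(1) H_minus[OF that(2)]] by simp
  have ex: "\<exists>c\<in>K. x - c * a \<in> H" for x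
  proof (cases "x \<in> H")
    case True
    then show ?thesis using sub_division_ringD(1)[OF K] by (intro bexI[of _ 0]) auto
  next
    case False
    \<comment> \<open>\<open>X\<close> is the left subspace generated by \<open>H\<close> and
      \<open>x\<close>. By maximality it contains \<open>a\<close>, and solving
      \<open>a = h + k * x\<close> for \<open>x\<close> yields the coefficient
      \<open>inverse k\<close>.\<close>
    define X where "X = {h + k * x | h k. h \<in> H \<and> k \<in> K}"
    have "y \<in> X" if "y \<in> H" for y
    proof -
      have "y = y + 0 * x" by simp
      then show ?thesis unfolding X_def using that sub_division_ringD(1)[OF K] by blast
    qed
    then have HX: "H \<subseteq> X" by blast
    have "lsub X"
      unfolding lsub_def
    proof (intro conjI ballI)
      show "K \<subseteq> X" using H_K HX by blast
    next
      fix y z assume "y \<in> X" "z \<in> X"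
      then obtain h1 k1 h2 k2 where *: "y = h1 + k1 * x" "z = h2 + k2 * x" "h1 \<in> H" "h2 \<in> H" "k1 \<in> K" "k2 \<in> K"
        unfolding X_def by blast
      have "y + z = (h1 + h2) + (k1 + k2) * x" using * by (simp add: algebra_simps)
      then show "y + z \<in> X" unfolding X_def using * H_add sub_division_ringD(7)[OF K] by blast
    next
      fix k y assume "k \<in> K" "y \<in> X"
      then obtain h1 k1 where *: "y = h1 + k1 * x" "h1 \<in> H" "k1 \<in> K"
        unfolding X_def by blast
      have "k * y = k * h1 + (k * k1) * x" using * by (simp add: algebra_simps)
      then show "k * y \<in> X"
        unfolding X_def using * \<open>k \<in> K\<close> H_mult sub_division_ringD(4)[OF K] by blast
    qed
    moreover have "x \<in> X"
    proof -
      have "x = 0 + 1 * x" by simp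
      then show ?thesis
        unfolding X_def using H_K sub_division_ringD(1,2)[OF K] by blast
    qed
    ultimately have "a \<in> X" using max[of X] HX False by blast
    then obtain h k where hk: "a = h + k * x" "h \<in> H" "k \<in> K" unfolding X_def by blast
    then have "k \<noteq> 0" using H(2) by auto
    then have "x - inverse k * a = - (inverse k * h)"
      using hk(1) by (simp add: algebra_simps mult.assoc[symmetric])
    moreover have "- (inverse k * h) \<in> H"
      using hk H_minus H_mult sub_division_ringD(5)[OF K] by blast
    ultimately show ?thesis using sub_division_ringD(5)[OF K hk(3)] by metis
  qed
  have uniq: "c = d" if "c \<in> K" "d \<in> K" "x - c * a \<in> H" "x - d * a \<in> H" for c d x
  proof (rule ccontr)
    assume "c \<noteq> d"
    have "(x - d * a) - (x - c * a) \<in> H" by (rule H_diff[OF that(4,3)])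
    moreover have "(x - d * a) - (x - c * a) = (c - d) * a" by (simp add: algebra_simps)
    ultimately have "inverse (c - d) * ((c - d) * a) \<in> H"
      using that sub_division_ringD(3,5)[OF K] H_mult by simp
    then show False using \<open>c \<noteq> d\<close> H(2) by (simp add: mult.assoc[symmetric])
  qed
  define \<phi> where "\<phi> x = (THE c. c \<in> K \<and> x - c * a \<in> H)" for x
  have phi: "\<phi> x = c" if "c \<in> K" "x - c * a \<in> H" for x c
    unfolding \<phi>_def using that uniq by blast
  have phi': "\<phi> x \<in> K \<and> x - \<phi> x * a \<in> H" for x
    using ex[of x] phi by blast
  show ?thesis
  proof (rule that[of \<phi>])
    show "left_linear K \<phi>"
      unfolding left_linear_def
    proof (intro conjI allI ballI)
      fix x y
      have "(x - \<phi> x * a) + (y - \<phi> y * a) \<in> H" using phi' H_add by blast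
      then show "\<phi> (x + y) = \<phi> x + \<phi> y"
        using phi' sub_division_ringD(7)[OF K] by (intro phi) (auto simp: algebra_simps)
    next
      fix k x assume k: "k \<in> K"
      have "k * (x - \<phi> x * a) \<in> H" using k phi' H_mult by blast
      then show "\<phi> (k * x) = k * \<phi> x"
        using k phi' sub_division_ringD(4)[OF K] by (intro phi) (auto simp: algebra_simps mult.assoc)
    qed
    show "\<phi> 1 = 0" using H_K sub_division_ringD(1,2)[OF K] by (intro phi) auto
    have "0 \<in> H" using H_K sub_division_ringD(1)[OF K] by blast
    then show "\<phi> a = 1" using sub_division_ringD(2)[OF K] by (intro phi) auto
    show "range \<phi> \<subseteq> K" using phi' by blast
  qed
qed

locale rational_structure = based_right_vector_space scale m E
  for scale :: "'v::ab_group_add \<Rightarrow> 'k::division_ring \<Rightarrow> 'v" and m :: nat and E :: "nat \<Rightarrow> 'v" +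
  fixes K :: "'k set"
  assumes sub_K: "sub_division_ring K"
begin

definition ratvec :: "'v set" where
  "ratvec = {v. \<forall>i. coord v i \<in> K}"

text \<open>Asking for a span by rational vectors, not for a rational basis, avoids any choice of
  bases when sums and intersections are formed.\<close>

definition rat :: "'v set \<Rightarrow> bool" where
  "rat U \<longleftrightarrow> rsubspace scale U \<and> U \<subseteq> rspan (U \<inter> ratvec)"

lemma ratD: "rat U \<Longrightarrow> rsubspace scale U" "rat U \<Longrightarrow> rspan (U \<inter> ratvec) = U"
  using rspan_least[of U "U \<inter> ratvec"] by (auto simp: rat_def)

lemma rat_rspan: "B \<subseteq> ratvec \<Longrightarrow> rat (rspan B)"
  unfolding rat_def using rsubspace_rspan rspan_superset[of B] by (intro conjI rspan_mono) auto

lemma rational_subspace_rat: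
  assumes "rational_subspace scale m E K U"
  shows "rat U"
proof -
  obtain B where B: "rbasis scale B U" "B \<subseteq> rational_vectors scale m E K"
    using assms by (auto simp: rational_subspace_def)
  have "v \<in> ratvec" if v: "v \<in> rational_vectors scale m E K" for v
  proof -
    obtain S c where S: "finite S" "S \<subseteq> E ` {1..m}" "c ` S \<subseteq> K" "v = (\<Sum>b\<in>S. scale b (c b))"
      using v by (auto simp: rational_vectors_def combinations_def)
    have "coord b i * c b \<in> K" if "b \<in> S" for b i
      using that S by (auto intro!: sub_division_ringD[OF sub_K] simp: coords_E)
    then show ?thesis
      by (auto simp: ratvec_def S(4) coords_sum_distrib coords_scale intro!: sub_division_ring_sum[OF sub_K])
  qed
  then have "B \<subseteq> ratvec" using B(2) by blast
  then show ?thesis using rat_rspan B(1) by (auto simp: rbasis_def)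
qed

lemma rat_plus:
  assumes "rat U" "rat W"
  shows "rat (U + W)"
proof -
  have "U + W = rspan (U \<inter> ratvec \<union> W \<inter> ratvec)"
    using assms by (simp add: rspan_Un ratD)
  then show ?thesis using rat_rspan[of "U \<inter> ratvec \<union> W \<inter> ratvec"] by auto
qed

definition coordwise :: "('k \<Rightarrow> 'k) \<Rightarrow> 'v \<Rightarrow> 'v" where
  "coordwise \<phi> v = (\<Sum>i=1..m. scale (E i) (\<phi> (coord v i)))"

lemma left_linear_zero: "left_linear K \<phi> \<Longrightarrow> \<phi> 0 = 0"
  using sub_division_ringD(1)[OF sub_K] unfolding left_linear_def by (metis mult_zero_left)

lemma coords_coordwise: "left_linear K \<phi> \<Longrightarrow> coord (coordwise \<phi> v) i = \<phi> (coord v i)"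
  unfolding coordwise_def
  by (cases "i \<in> {1..m}") (simp_all only: coords_sum_scale coords_outside left_linear_zero not_False_eq_True)

lemma rat_coordwise:
  assumes "rat U" "left_linear K \<phi>" "v \<in> U"
  shows "coordwise \<phi> v \<in> U"
proof -
  \<comment> \<open>All \<open>\<psi>\<close> must be treated at once: applying
    \<open>\<psi>\<close> to \<open>scale v a\<close> amounts to applying the different map
    \<open>x \<mapsto> \<psi> (x * a)\<close> to \<open>v\<close>, which is again left
    linear.\<close>
  let ?W = "{v \<in> U. \<forall>\<psi>. left_linear K \<psi> \<longrightarrow> coordwise \<psi> v \<in> U}"
  have sub: "rsubspace scale U" by (rule ratD[OF assms(1)])
  have "rsubspace scale ?W"
    unfolding rsubspace_def
  proof (intro conjI ballI allI)
    have "coordwise \<psi> 0 = 0" if "left_linear K \<psi>" for \<psi>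
      using that by (simp add: coordwise_def left_linear_zero)
    then show "0 \<in> ?W" using rsubspaceD(1)[OF sub] by simp
  next
    fix v w assume vw: "v \<in> ?W" "w \<in> ?W"
    have "coordwise \<psi> (v + w) = coordwise \<psi> v + coordwise \<psi> w" if "left_linear K \<psi>" for \<psi>
      using that by (simp add: coordwise_def coords_add left_linear_def scale_add_right sum.distrib)
    then show "v + w \<in> ?W" using vw rsubspaceD(2)[OF sub] by simp
  next
    fix v a assume v: "v \<in> ?W"
    have "coordwise \<psi> (scale v a) \<in> U" if \<psi>: "left_linear K \<psi>" for \<psi>
    proof -
      have "left_linear K (\<lambda>x. \<psi> (x * a))"
        using \<psi> by (simp add: left_linear_def distrib_right mult.assoc)
      then have "coordwise (\<lambda>x. \<psi> (x * a)) v \<in> U" using v by blast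
      then show ?thesis by (simp add: coordwise_def coords_scale)
    qed
    then show "scale v a \<in> ?W" using v rsubspaceD(3)[OF sub] by simp
  qed
  moreover have "U \<inter> ratvec \<subseteq> ?W"
  proof
    fix v assume v: "v \<in> U \<inter> ratvec"
    \<comment> \<open>Coordinates in \<open>K\<close> can be pulled out of \<open>\<psi>\<close> on
      the left, so on a rational vector the map is a scaling and stays inside
      \<open>U\<close>.\<close>
    have "coordwise \<psi> v = scale v (\<psi> 1)" if \<psi>: "left_linear K \<psi>" for \<psi>
    proof -
      have "coord v i \<in> K" for i using v by (simp add: ratvec_def)
      then have "\<psi> (coord v i * 1) = coord v i * \<psi> 1" for i
        using \<psi> unfolding left_linear_def by blast
      then have "coordwise \<psi> v = scale (\<Sum>i=1..m. scale (E i) (coord v i)) (\<psi> 1)"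
        by (simp add: coordwise_def scale_sum_left scale_scale)
      then show ?thesis using coords_sum[of v] by simp
    qed
    then show "v \<in> ?W" using v rsubspaceD(3)[OF sub] by simp
  qed
  ultimately have "rspan (U \<inter> ratvec) \<subseteq> ?W" by (rule rspan_least)
  then show ?thesis using assms ratD(2) by blast
qed

text \<open>Scale \<open>v\<close> so that some coordinate is \<open>1\<close>. If a coordinate \<open>a\<close> of \<open>v\<close> is not in \<open>K\<close>, choose
  \<open>\<phi>\<close> with \<open>\<phi> 1 = 0\<close> and \<open>\<phi> a = 1\<close>: then \<open>\<phi> v\<close> is rational, and subtracting \<open>\<phi> v a\<close> from \<open>v\<close>
  shrinks the support.\<close>

lemma ratI:
  assumes sub: "rsubspace scale U"
    and inv: "\<And>\<phi> v. left_linear K \<phi> \<Longrightarrow> v \<in> U \<Longrightarrow> coordwise \<phi> v \<in> U"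
  shows "rat U"
proof -
  have "v \<in> rspan (U \<inter> ratvec)" if "v \<in> U" for v
    using that
  proof (induction "card {i. coord v i \<noteq> 0}" arbitrary: v rule: less_induct)
    case less
    have "{i. coord v i \<noteq> 0} \<subseteq> {1..m}" using coords_outside[of _ v] by blast
    then have fin: "finite {i. coord v i \<noteq> 0}" by (rule finite_subset) simp
    show ?case
    proof (cases "v = 0")
      case True
      then show ?thesis using rsubspaceD(1)[OF rsubspace_rspan] by simp
    next
      case False
      then obtain i where i: "coord v i \<noteq> 0" using eq_zero_coords by blast
      define w where "w = scale v (inverse (coord v i))"
      have v: "v = scale w (coord v i)"
        using i by (simp add: w_def scale_scale scale_one)
      have wU: "w \<in> U" using less.prems rsubspaceD(3)[OF sub] by (simp add: w_def)
      have wi: "coord w i = 1" using i by (simp add: w_def coords_scale)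
      have supp: "coord v j \<noteq> 0 \<longleftrightarrow> coord w j \<noteq> 0" for j
        using i by (simp add: w_def coords_scale)
      have "w \<in> rspan (U \<inter> ratvec)"
      proof (cases "w \<in> ratvec")
        case True
        then show ?thesis using wU rspan_superset by blast
      next
        case False
        then obtain j where j: "coord w j \<notin> K" by (auto simp: ratvec_def)
        obtain \<phi> where phi: "left_linear K \<phi>" "\<phi> 1 = 0" "\<phi> (coord w j) = 1" "range \<phi> \<subseteq> K"
          using ex_left_linear_functional[OF sub_K j] .
        define u where "u = coordwise \<phi> w"
        have u: "coord u l = \<phi> (coord w l)" for l
          using coords_coordwise[OF phi(1)] by (simp add: u_def)
        have "u \<in> U" using inv[OF phi(1) wU] by (simp add: u_def)
        moreover have "u \<in> ratvec" using u phi(4) by (auto simp: ratvec_def)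
        ultimately have 1: "scale u (coord w j) \<in> rspan (U \<inter> ratvec)"
          using rspan_superset rsubspaceD(3)[OF rsubspace_rspan] by blast
        have coords: "coord (w - scale u (coord w j)) l = coord w l - \<phi> (coord w l) * coord w j" for l
          by (simp add: coords_diff coords_scale u)
        have "w - scale u (coord w j) \<in> rspan (U \<inter> ratvec)"
        proof (rule less.hyps)
          show "w - scale u (coord w j) \<in> U"
            using wU \<open>u \<in> U\<close> rsubspaceD(3,5)[OF sub] by blast
          have "coord w j \<noteq> 0" using j sub_division_ringD(1)[OF sub_K] by metis
          then have "j \<in> {i. coord v i \<noteq> 0}" using supp by simp
          moreover have "{i. coord (w - scale u (coord w j)) i \<noteq> 0} \<subseteq> {i. coord v i \<noteq> 0} - {j}"
            using supp phi(3) left_linear_zero[OF phi(1)] by (auto simp: coords)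
          ultimately have "{i. coord (w - scale u (coord w j)) i \<noteq> 0} \<subset> {i. coord v i \<noteq> 0}"
            by blast
          then show "card {i. coord (w - scale u (coord w j)) i \<noteq> 0} < card {i. coord v i \<noteq> 0}"
            by (rule psubset_card_mono[OF fin])
        qed
        then have "(w - scale u (coord w j)) + scale u (coord w j) \<in> rspan (U \<inter> ratvec)"
          using 1 by (rule rsubspaceD(2)[OF rsubspace_rspan])
        then show ?thesis by simp
      qed
      then have "scale w (coord v i) \<in> rspan (U \<inter> ratvec)" by (rule rsubspaceD(3)[OF rsubspace_rspan])
      then show ?thesis using v by simp
    qed
  qed
  then show ?thesis using sub by (auto simp: rat_def)
qed

text \<open>Invariance under coordinatewise maps passes to intersections at once, whereas common
  rational vectors are hard to exhibit directly.\<close>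

lemma rat_Int: "rat U \<Longrightarrow> rat W \<Longrightarrow> rat (U \<inter> W)"
  by (rule ratI) (auto intro: rat_coordwise rsubspace_Int ratD(1))

end

section \<open>A criterion for not being generated\<close>

text \<open>The closure in \<open>connected_nodes\<close> is reflexive, so an unjoined pair cannot
  consist of one node taken twice.\<close>

lemma not_connected_nodesE:
  assumes "\<not> connected_nodes G J"
  obtains s t where "s \<in> J" "t \<in> J" "s \<noteq> t"
  using assms unfolding connected_nodes_def by fastforce

text \<open>The flags whose members of types \<open>s\<close> and \<open>t\<close> are related by \<open>R\<close> form a subspace. A line of
  type \<open>J - {j} \<union> fr G j\<close> with \<open>j \<notin> {s, t}\<close> fixes both members, so only \<open>j = s\<close> and \<open>j = t\<close> need
  to be examined.\<close>

lemma not_rationally_generatedI: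
  fixes G :: "('v::ab_group_add set, 't) diagram_geometry" and R :: "'v set \<Rightarrow> 'v set \<Rightarrow> bool"
    and scale :: "'v \<Rightarrow> 'k::division_ring \<Rightarrow> 'v"
  assumes st: "s \<in> J" "t \<in> J" "s \<noteq> t"
    and refl: "\<And>X. X \<in> elements G \<Longrightarrow> incident G X X"
    and unique: "\<And>X Y. X \<in> elements G \<Longrightarrow> Y \<in> elements G \<Longrightarrow> incident G X Y \<Longrightarrow>
      type_of G X = type_of G Y \<Longrightarrow> X = Y"
    and line_s: "\<And>X1 X2 X Y. {X1, X2, X, Y} \<subseteq> elements G \<Longrightarrow> type_of G ` {X1, X2, X} = {s} \<Longrightarrow>
      type_of G Y = t \<Longrightarrow> X1 \<noteq> X2 \<Longrightarrow> \<forall>Z\<in>{X1, X2, X}. incident G Z Y \<Longrightarrow>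
      (\<And>j. j \<in> fr G s \<Longrightarrow>
        \<exists>L\<in>elements G. type_of G L = j \<and> (\<forall>Z\<in>{X1, X2, X, Y}. incident G L Z)) \<Longrightarrow>
      R X1 Y \<Longrightarrow> R X2 Y \<Longrightarrow> R X Y"
    and line_t: "\<And>Y1 Y2 Y X. {Y1, Y2, Y, X} \<subseteq> elements G \<Longrightarrow> type_of G ` {Y1, Y2, Y} = {t} \<Longrightarrow>
      type_of G X = s \<Longrightarrow> Y1 \<noteq> Y2 \<Longrightarrow> \<forall>Z\<in>{Y1, Y2, Y}. incident G X Z \<Longrightarrow>
      (\<And>j. j \<in> fr G t \<Longrightarrow>
        \<exists>L\<in>elements G. type_of G L = j \<and> (\<forall>Z\<in>{Y1, Y2, Y, X}. incident G L Z)) \<Longrightarrow>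
      R X Y1 \<Longrightarrow> R X Y2 \<Longrightarrow> R X Y"
    and rational: "\<And>X Y. X \<in> elements G \<Longrightarrow> Y \<in> elements G \<Longrightarrow> type_of G X = s \<Longrightarrow> type_of G Y = t \<Longrightarrow>
      incident G X Y \<Longrightarrow> rational_subspace scale m E K X \<Longrightarrow> rational_subspace scale m E K Y \<Longrightarrow> R X Y"
    and C: "flag G C" "J \<subseteq> type_of G ` C"
    and bad: "X0 \<in> C" "Y0 \<in> C" "type_of G X0 = s" "type_of G Y0 = t" "\<not> R X0 Y0"
  shows "\<not> rationally_generated scale m E K (Gr G J)"
proof
  assume gen: "rationally_generated scale m E K (Gr G J)"
  have inc: "incident G X Y" if "flag G F" "X \<in> F" "Y \<in> F" for F X Y
    using that refl by (cases "X = Y") (auto simp: flag_def pairwise_def)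
  have same: "X = Y" if "flag G F" "X \<in> F" "Y \<in> F" "type_of G X = type_of G Y" for F X Y
    using unique[OF _ _ inc[OF that(1-3)] that(4)] that by (auto simp: flag_def)
  have el: "X \<in> elements G" if "flag G F" "X \<in> F" for F X
    using that by (auto simp: flag_def)
  have pts: "points (Gr G J) = flags_of_type G J" by (simp add: Gr_def)
  define S where "S = {p \<in> flags_of_type G J.
    \<forall>X\<in>p. \<forall>Y\<in>p. type_of G X = s \<longrightarrow> type_of G Y = t \<longrightarrow> R X Y}"
  \<comment> \<open>A flag has at most one member of each type, so a single related pair decides
    membership in \<open>S\<close>.\<close>
  have SI: "p \<in> S" if "p \<in> flags_of_type G J" "X \<in> p" "Y \<in> p" "type_of G X = s" "type_of G Y = t" "R X Y"
    for p X Y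
    using that same[of p] unfolding S_def flags_of_type_def by blast
  have SD: "R X Y" if "p \<in> S" "X \<in> p" "Y \<in> p" "type_of G X = s" "type_of G Y = t" for p X Y
    using that by (simp add: S_def)
  have "geo_subspace (Gr G J) S"
    unfolding geo_subspace_def
  proof (intro conjI ballI impI subsetI)
    show "p \<in> points (Gr G J)" if "p \<in> S" for p using that by (simp add: S_def pts)
  next
    fix l p
    assume "l \<in> lines (Gr G J)"
      and "\<exists>p\<in>S. \<exists>q\<in>S. p \<noteq> q \<and> on_line (Gr G J) p l \<and> on_line (Gr G J) q l"
      and "p \<in> {p \<in> points (Gr G J). on_line (Gr G J) p l}"
    then obtain j p1 p2 where j: "j \<in> J" and l: "type_of G ` l = J - {j} \<union> fr G j"
      and p12: "p1 \<in> S" "p2 \<in> S" "p1 \<noteq> p2" "flag G (p1 \<union> l)" "flag G (p2 \<union> l)"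
      and p: "p \<in> flags_of_type G J" "flag G (p \<union> l)"
      by (auto simp: Gr_def flags_of_type_def)
    have tp: "type_of G ` q = J" if "q \<in> {p1, p2, p}" for q
      using that p12 p by (auto simp: S_def flags_of_type_def)
    have fl: "flag G (q \<union> l)" if "q \<in> {p1, p2, p}" for q
      using that p12 p by auto
    \<comment> \<open>The union of a point and a line through it is again a flag; members of equal
      type therefore coincide, and the line prescribes every member of its points except possibly
      the one of type \<open>j\<close>.\<close>
    have agree: "X \<in> q" if q: "q \<in> {p1, p2, p}" "X \<in> l" "type_of G X \<in> J" for q X
    proof -
      obtain Y where Y: "Y \<in> q" "type_of G Y = type_of G X"
        using tp[OF q(1)] q(3) by (metis (no_types, lifting) imageE)
      then have "Y = X" using same[OF fl[OF q(1)], of Y X] q(2) by blast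
      then show ?thesis using Y by simp
    qed
    have ex_l: "\<exists>X\<in>l. type_of G X = i" if "i \<in> J" "i \<noteq> j" for i
    proof -
      have "i \<in> type_of G ` l" using l that by simp
      then show ?thesis by blast
    qed
    have ex_q: "\<exists>X\<in>q. type_of G X = j" if "q \<in> {p1, p2, p}" for q
    proof -
      have "j \<in> type_of G ` q" using tp[OF that] j by simp
      then show ?thesis by blast
    qed
    have ex_fr: "\<exists>L\<in>l. type_of G L = i" if "i \<in> fr G j" for i
    proof -
      have "i \<in> type_of G ` l" using l that by simp
      then show ?thesis by blast
    qed
    obtain X1 X2 X where X: "X1 \<in> p1" "X2 \<in> p2" "X \<in> p"
      and tX: "type_of G X1 = j" "type_of G X2 = j" "type_of G X = j"
      using ex_q[of p1] ex_q[of p2] ex_q[of p] by blast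
    \<comment> \<open>Two points of the line with the same member of type \<open>j\<close> are
      equal; this is how distinct points give \<open>X1 \<noteq> X2\<close>.\<close>
    have sub: "q \<subseteq> q'" if q: "q \<in> {p1, p2, p}" "q' \<in> {p1, p2, p}" "Z \<in> q" "Z \<in> q'" "type_of G Z = j"
      for q q' Z
    proof
      fix W assume W: "W \<in> q"
      have tW: "type_of G W \<in> J" using tp[OF q(1)] W by blast
      show "W \<in> q'"
      proof (cases "type_of G W = j")
        case True
        then have "W = Z" using same[OF fl[OF q(1)], of W Z] W q by simp
        then show ?thesis using q by simp
      next
        case False
        then obtain V where V: "V \<in> l" "type_of G V = type_of G W" using ex_l tW by blast
        then have "V = W" using same[OF fl[OF q(1)], of V W] W by simp
        then show ?thesis using agree[OF q(2) V(1)] V(2) tW by simp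
      qed
    qed
    have X12: "X1 \<noteq> X2"
      using sub[of p1 p2 X1] sub[of p2 p1 X1] X tX p12(3) by auto
    have elems: "X1 \<in> elements G" "X2 \<in> elements G" "X \<in> elements G"
      using el[OF fl] X by auto
    have common: "\<exists>L\<in>elements G. type_of G L = i \<and> (\<forall>Z\<in>{X1, X2, X, Y}. incident G L Z)"
      if "i \<in> fr G j" "Y \<in> l" for i Y
    proof -
      obtain L where L: "L \<in> l" "type_of G L = i" using ex_fr \<open>i \<in> fr G j\<close> by blast
      then have "\<forall>Z\<in>{X1, X2, X, Y}. incident G L Z"
        using inc[OF fl] X \<open>Y \<in> l\<close> by auto
      then show ?thesis using L el[OF fl] by blast
    qed
    consider "j = s" | "j = t" | "j \<noteq> s" "j \<noteq> t" by blast
    then show "p \<in> S"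
    proof cases
      case 1
      then obtain Y where Y: "Y \<in> l" "type_of G Y = t" using ex_l st by blast
      then have Yq: "Y \<in> p1" "Y \<in> p2" "Y \<in> p" using agree[of _ Y] st by auto
      have inci: "\<forall>Z\<in>{X1, X2, X}. incident G Z Y" using inc[OF fl] X Y by auto
      have "R X Y"
      proof (rule line_s[of X1 X2 X Y])
        show "{X1, X2, X, Y} \<subseteq> elements G" using elems el[OF fl, of p Y] Y by auto
        show "\<exists>L\<in>elements G. type_of G L = i \<and> (\<forall>Z\<in>{X1, X2, X, Y}. incident G L Z)"
          if "i \<in> fr G s" for i using common that 1 Y by blast
        show "R X1 Y" "R X2 Y" using SD[OF p12(1) X(1) Yq(1)] SD[OF p12(2) X(2) Yq(2)] tX 1 Y by auto
      qed (use tX 1 Y X12 inci in auto)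
      then show ?thesis using SI[OF p(1) X(3) Yq(3)] tX 1 Y by simp
    next
      case 2
      then obtain Y where Y: "Y \<in> l" "type_of G Y = s" using ex_l st by blast
      then have Yq: "Y \<in> p1" "Y \<in> p2" "Y \<in> p" using agree[of _ Y] st by auto
      have inci: "\<forall>Z\<in>{X1, X2, X}. incident G Y Z" using inc[OF fl] X Y by auto
      have "R Y X"
      proof (rule line_t[of X1 X2 X Y])
        show "{X1, X2, X, Y} \<subseteq> elements G" using elems el[OF fl, of p Y] Y by auto
        show "\<exists>L\<in>elements G. type_of G L = i \<and> (\<forall>Z\<in>{X1, X2, X, Y}. incident G L Z)"
          if "i \<in> fr G t" for i using common that 2 Y by blast
        show "R Y X1" "R Y X2" using SD[OF p12(1) Yq(1) X(1)] SD[OF p12(2) Yq(2) X(2)] tX 2 Y by auto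
      qed (use tX 2 Y X12 inci in auto)
      then show ?thesis using SI[OF p(1) Yq(3) X(3)] tX 2 Y by simp
    next
      case 3
      then obtain Y Z where YZ: "Y \<in> l" "type_of G Y = s" "Z \<in> l" "type_of G Z = t"
        using ex_l st by metis
      then have "R Y Z" using SD[OF p12(1)] agree[of p1] st by blast
      then show ?thesis using SI[OF p(1)] agree[of p] YZ st by blast
    qed
  qed
  moreover have "{p \<in> points (Gr G J). rational_flag scale m E K p} \<subseteq> S"
    unfolding pts S_def rational_flag_def
  proof safe
    fix p X Y
    assume "p \<in> flags_of_type G J" and *: "X \<in> p" "Y \<in> p" "s = type_of G X" "t = type_of G Y"
      and rat: "\<forall>U\<in>p. rational_subspace scale m E K U"
    then have "flag G p" by (simp add: flags_of_type_def)
    then show "R X Y" using * rat by (intro rational inc[of p] el[of p]) auto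
  qed
  ultimately have "geo_span (Gr G J) {p \<in> points (Gr G J). rational_flag scale m E K p} \<subseteq> S"
    unfolding geo_span_def by blast
  then have "flags_of_type G J \<subseteq> S" using gen pts by (simp add: rationally_generated_def)
  \<comment> \<open>\<open>C\<close> may have more types than \<open>J\<close>; cutting it down to
    \<open>J\<close> gives a point that would have to lie in \<open>S\<close>.\<close>
  moreover have "{X \<in> C. type_of G X \<in> J} \<in> flags_of_type G J"
    using C by (auto simp: flags_of_type_def flag_def pairwise_def)
  ultimately have "R X0 Y0" using SD[of "{X \<in> C. type_of G X \<in> J}" X0 Y0] bad st by blast
  then show False using bad by blast
qed

section \<open>Rational subspaces between two members of a flag\<close>

context based_right_vector_space
begin

lemma rdim_Int_less:
  assumes "rsubspace scale X" "rsubspace scale Y" "X \<noteq> Y" "rdim scale X = rdim scale Y"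
  shows "rdim scale (X \<inter> Y) < rdim scale X"
proof (rule rdim_strict_mono)
  have "\<not> X \<subseteq> Y" using rsubspace_eqI[OF assms(1,2)] assms(3,4) by auto
  then show "X \<inter> Y \<subset> X" by blast
qed (use assms rsubspace_Int in auto)

text \<open>Distinct subspaces of equal dimension meet in a smaller one, so their sum gains at least
  one dimension, which is all that \<open>L\<close> allows.\<close>

lemma plus_eqI:
  assumes "rsubspace scale X" "rsubspace scale Y" "rsubspace scale L"
    and "X \<noteq> Y" "rdim scale X = rdim scale Y" "X \<subseteq> L" "Y \<subseteq> L" "rdim scale L \<le> rdim scale X + 1"
  shows "X + Y = L"
proof (rule rsubspace_eqI)
  show "X + Y \<subseteq> L" using assms by (intro plus_least)
  show "rdim scale L \<le> rdim scale (X + Y)"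
    using rdim_Int_less[OF assms(1,2,4,5)] rdim_plus_Int[OF assms(1,2)] assms(5,8) by simp
qed (use assms rsubspace_plus in auto)

end

context rational_structure
begin

definition between :: "'v set \<Rightarrow> 'v set \<Rightarrow> bool" where
  "between X Y \<longleftrightarrow> (\<exists>Z. rat Z \<and> X \<subseteq> Z \<and> Z \<subseteq> Y)"

lemma between_rational: "rational_subspace scale m E K X \<Longrightarrow> X \<subseteq> Y \<Longrightarrow> between X Y"
  using rational_subspace_rat by (auto simp: between_def)

text \<open>\<open>L\<close> need not be an element of the building: in type D the space of
  dimension \<open>n - 1\<close> above the members of dimension \<open>n - 2\<close> is only an
  intersection of two maximal subspaces.\<close>

lemma between_lower:
  assumes "rsubspace scale X1" "rsubspace scale X2" "rsubspace scale L" "rsubspace scale Y"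
    and "X1 \<noteq> X2" "rdim scale X1 = rdim scale X2" "rdim scale L \<le> rdim scale X1 + 1"
    and "X1 \<subseteq> L" "X2 \<subseteq> L" "X \<subseteq> L"
    and "between X1 Y" "between X2 Y"
  shows "between X Y"
proof -
  obtain Z1 Z2 where Z: "rat Z1" "X1 \<subseteq> Z1" "Z1 \<subseteq> Y" "rat Z2" "X2 \<subseteq> Z2" "Z2 \<subseteq> Y"
    using assms(11,12) by (auto simp: between_def)
  have "X1 + X2 = L" using assms by (intro plus_eqI)
  then have "X \<subseteq> Z1 + Z2" using assms(10) set_plus_mono2[OF Z(2,5)] by blast
  moreover have "Z1 + Z2 \<subseteq> Y" using Z assms(4) by (intro plus_least)
  ultimately show ?thesis using rat_plus[OF Z(1,4)] by (auto simp: between_def)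
qed

text \<open>Bounding the dimension of \<open>Y1 \<inter> Y2\<close> by that of \<open>L\<close>,
  instead of fixing a codimension, covers both ordinary members, where the codimension is one, and
  maximal singular subspaces of one class, where it is two.\<close>

lemma between_upper:
  assumes "rsubspace scale Y1" "rsubspace scale Y2" "rsubspace scale L"
    and "rdim scale (Y1 \<inter> Y2) \<le> rdim scale L" "L \<subseteq> Y1" "L \<subseteq> Y2" "L \<subseteq> Y"
    and "between X Y1" "between X Y2"
  shows "between X Y"
proof -
  obtain Z1 Z2 where Z: "rat Z1" "X \<subseteq> Z1" "Z1 \<subseteq> Y1" "rat Z2" "X \<subseteq> Z2" "Z2 \<subseteq> Y2"
    using assms(8,9) by (auto simp: between_def)
  have "L = Y1 \<inter> Y2" using assms by (intro rsubspace_eqI rsubspace_Int) auto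
  then have "Z1 \<inter> Z2 \<subseteq> Y" using Z assms(7) by blast
  then show ?thesis using rat_Int[OF Z(1,4)] Z by (auto simp: between_def)
qed

text \<open>A rational subspace of \<open>Y\<close> is spanned by vectors with vanishing
  \<open>i\<close>-th coordinate, so it cannot contain \<open>v\<close>.\<close>

lemma not_between:
  assumes "v \<in> X" "coord v i \<noteq> 0"
    and "\<And>u. u \<in> Y \<Longrightarrow> u \<in> ratvec \<Longrightarrow> coord u i = 0"
  shows "\<not> between X Y"
proof
  assume "between X Y"
  then obtain Z where Z: "rat Z" "X \<subseteq> Z" "Z \<subseteq> Y" by (auto simp: between_def)
  have "rsubspace scale {u. coord u i = 0}"
    by (auto simp: rsubspace_def coords_simps)
  then have "rspan (Z \<inter> ratvec) \<subseteq> {u. coord u i = 0}"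
    using Z(3) assms(3) by (intro rspan_least) auto
  then show False using Z ratD(2)[OF Z(1)] assms(1,2) by blast
qed

end

section \<open>Type A\<close>

lemma A_not_generated:
  fixes scale :: "'v::ab_group_add \<Rightarrow> 'k::division_ring \<Rightarrow> 'v"
  assumes "rational_structure scale m E K" "K \<noteq> UNIV" and m: "n < m"
    and J: "J \<subseteq> {1..n}" "s \<in> J" "t \<in> J" "s < t"
  shows "\<not> rationally_generated scale m E K (Gr (A_building scale n) J)"
proof -
  interpret rational_structure scale m E K by fact
  obtain a where a: "a \<notin> K" using assms(2) by blast
  define w where "w i = (if i = 1 then E 1 + scale (E 2) a else E (i + 1))" for i
  define p where "p i = (if i = 1 then 1 else i + 1)" for i :: nat
  define F where "F k = rspan (w ` {1..k})" for k
  have n: "1 \<le> s" "s < t" "t \<le> n" using J by auto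
  have piv: "coord (w i) (p j) = (if i = j then 1 else 0)" if "i \<in> {1..n}" "j \<in> {1..n}" for i j
    using that n m by (auto simp: w_def p_def coords_simps)
  have dimF: "rdim scale (F k) = k" if "k \<le> n" for k
    unfolding F_def using rdim_pivots[of "{1..k}" w p] piv that by simp
  have subF: "rsubspace scale (F k)" for k
    by (simp add: F_def rsubspace_rspan)
  have monoF: "F k \<subseteq> F l" if "k \<le> l" for k l
    unfolding F_def using that by (intro rspan_mono image_mono) auto
  let ?G = "A_building scale n"
  have G: "X \<in> elements ?G \<longleftrightarrow> rsubspace scale X \<and> rdim scale X \<in> {1..n}"
    "type_of ?G X = rdim scale X" "incident ?G X Y \<longleftrightarrow> X \<subseteq> Y \<or> Y \<subseteq> X"
    "fr ?G i = {j \<in> {1..n}. j = i + 1 \<or> i = j + 1}" for X Y i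
    by (auto simp: A_building_def fr_def)
  have below: "X \<subseteq> Y" if "rsubspace scale X" "rsubspace scale Y" "X \<subseteq> Y \<or> Y \<subseteq> X"
    "rdim scale X \<le> rdim scale Y" for X Y
    using that rsubspace_eqI[of Y X] by auto
  show ?thesis
  proof (rule not_rationally_generatedI[where s = s and t = t and R = between
        and C = "F ` {1..n}" and ?X0.0 = "F s" and ?Y0.0 = "F t"])
    fix X Y assume "X \<in> elements ?G" "Y \<in> elements ?G" "incident ?G X Y" "type_of ?G X = type_of ?G Y"
    then have "rsubspace scale X" "rsubspace scale Y" "X \<subseteq> Y \<or> Y \<subseteq> X" "rdim scale X = rdim scale Y"
      by (simp_all add: G)
    then show "X = Y" using rsubspace_eqI[of X Y] rsubspace_eqI[of Y X] by auto
  next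
    fix X1 X2 X Y
    assume *: "{X1, X2, X, Y} \<subseteq> elements ?G" "type_of ?G ` {X1, X2, X} = {s}" "type_of ?G Y = t"
      "X1 \<noteq> X2"
      "\<And>j. j \<in> fr ?G s \<Longrightarrow> \<exists>L\<in>elements ?G. type_of ?G L = j \<and> (\<forall>Z\<in>{X1, X2, X, Y}. incident ?G L Z)"
      and b: "between X1 Y" "between X2 Y"
    have d: "rdim scale X1 = s" "rdim scale X2 = s" "rdim scale X = s"
      and sub: "rsubspace scale X1" "rsubspace scale X2" "rsubspace scale X" "rsubspace scale Y"
      using *(1,2) by (auto simp: G)
    \<comment> \<open>The node \<open>s + 1\<close> exists because \<open>s < t\<close>. It may be
      \<open>t\<close> itself, and then \<open>L\<close> is \<open>Y\<close>.\<close>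
    have "s + 1 \<in> fr ?G s" using n by (auto simp: G)
    then obtain L where L: "L \<in> elements ?G" "type_of ?G L = s + 1" "\<forall>Z\<in>{X1, X2, X, Y}. incident ?G L Z"
      using *(5) by blast
    then have L': "rsubspace scale L" "rdim scale L = s + 1" by (auto simp: G)
    have "Z \<subseteq> L" if "Z \<in> {X1, X2, X}" for Z
    proof (rule below)
      show "rsubspace scale Z" "rdim scale Z \<le> rdim scale L" using that d sub L'(2) by auto
      have "incident ?G L Z" using that L(3) by blast
      then show "Z \<subseteq> L \<or> L \<subseteq> Z" by (auto simp: G)
    qed (rule L')
    then show "between X Y"
      using between_lower[OF sub(1,2) L'(1) sub(4) *(4), of X] L' d b by simp
  next
    fix Y1 Y2 Y X
    assume *: "{Y1, Y2, Y, X} \<subseteq> elements ?G" "type_of ?G ` {Y1, Y2, Y} = {t}" "type_of ?G X = s"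
      "Y1 \<noteq> Y2"
      "\<And>j. j \<in> fr ?G t \<Longrightarrow> \<exists>L\<in>elements ?G. type_of ?G L = j \<and> (\<forall>Z\<in>{Y1, Y2, Y, X}. incident ?G L Z)"
      and b: "between X Y1" "between X Y2"
    have d: "rdim scale Y1 = t" "rdim scale Y2 = t" "rdim scale Y = t"
      and sub: "rsubspace scale Y1" "rsubspace scale Y2" "rsubspace scale Y" "rsubspace scale X"
      using *(1,2) by (auto simp: G)
    have "t - 1 \<in> fr ?G t" using n by (auto simp: G)
    then obtain L where L: "L \<in> elements ?G" "type_of ?G L = t - 1" "\<forall>Z\<in>{Y1, Y2, Y, X}. incident ?G L Z"
      using *(5) by blast
    then have L': "rsubspace scale L" "rdim scale L = t - 1" by (auto simp: G)
    have "L \<subseteq> Z" if "Z \<in> {Y1, Y2, Y}" for Z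
    proof (rule below)
      show "rsubspace scale Z" "rdim scale L \<le> rdim scale Z" using that d sub L'(2) by auto
      have "incident ?G L Z" using that L(3) by blast
      then show "L \<subseteq> Z \<or> Z \<subseteq> L" by (auto simp: G)
    qed (rule L')
    then show "between X Y"
      using between_upper[OF sub(1,2) L'(1), of Y X] L' d b rdim_Int_less[OF sub(1,2) *(4)] by simp
  next
    fix X Y
    assume "X \<in> elements ?G" "Y \<in> elements ?G" "type_of ?G X = s" "type_of ?G Y = t" "incident ?G X Y"
      and r: "rational_subspace scale m E K X"
    then have "X \<subseteq> Y" using n by (intro below) (simp_all add: G)
    then show "between X Y" using between_rational r by blast
  next
    show "flag ?G (F ` {1..n})"
    proof -
      have "incident ?G (F k) (F l)" for k l
        using monoF[of k l] monoF[of l k] by (cases "k \<le> l") (auto simp: G)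
      moreover have "F ` {1..n} \<subseteq> elements ?G" using subF dimF by (auto simp: G)
      ultimately show ?thesis by (auto simp: flag_def pairwise_def)
    qed
    have "type_of ?G ` F ` {1..n} = (\<lambda>k. k) ` {1..n}"
      unfolding image_image G(2) using dimF by (intro image_cong) auto
    then show "J \<subseteq> type_of ?G ` F ` {1..n}" using J(1) by simp
    show "type_of ?G (F s) = s" "type_of ?G (F t) = t" using n dimF by (auto simp: G)
    have "w 1 \<in> F s" unfolding F_def using n rspan_superset[of "w ` {1..s}"] by auto
    moreover have "coord (w 1) 1 = 1" using piv[of 1 1] n by (simp add: p_def)
    moreover have "coord u 1 = 0" if u: "u \<in> F t" "u \<in> ratvec" for u
    proof -
      have "rsubspace scale {v. coord v 2 = a * coord v 1}"
        by (auto simp: rsubspace_def coords_simps algebra_simps)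
      moreover have "w ` {1..t} \<subseteq> {v. coord v 2 = a * coord v 1}"
        using n m by (auto simp: w_def coords_simps)
      ultimately have "F t \<subseteq> {v. coord v 2 = a * coord v 1}"
        unfolding F_def by (rule rspan_least)
      then have eq: "coord u 2 = a * coord u 1" using u by blast
      show ?thesis
      proof (rule ccontr)
        assume "coord u 1 \<noteq> 0"
        then have "a = coord u 2 * inverse (coord u 1)" using eq by (simp add: mult.assoc)
        then show False
          using a u(2) sub_division_ringD(4,5)[OF sub_K] by (auto simp: ratvec_def)
      qed
    qed
    ultimately show "\<not> between (F s) (F t)" using not_between[of "w 1" "F s" 1 "F t"] by simp
    show "F s \<in> F ` {1..n}" "F t \<in> F ` {1..n}" using n by auto
    show "s \<in> J" "t \<in> J" "s \<noteq> t" using J by auto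
    show "incident ?G X X" for X by (simp add: G)
  qed
qed

section \<open>The hyperbolic quadratic form\<close>

locale hyperbolic_space = rational_structure scale "2 * n" E K
  for scale :: "'v::ab_group_add \<Rightarrow> 'k::field \<Rightarrow> 'v" and n :: nat and E :: "nat \<Rightarrow> 'v" and K :: "'k set"
begin

abbreviation q :: "'v \<Rightarrow> 'k" where
  "q \<equiv> quad_form scale n E"

text \<open>The polar form of \<open>q\<close>, as \<open>q_add\<close> shows. In characteristic 2
  its vanishing on a subspace does not make the subspace singular, so singularity is always tested
  with \<open>q\<close>.\<close>

definition b :: "'v \<Rightarrow> 'v \<Rightarrow> 'k" where
  "b v w = (\<Sum>i=1..n. coord v (2 * i - 1) * coord w (2 * i) + coord v (2 * i) * coord w (2 * i - 1))"

lemma q_add: "q (v + w) = q v + q w + b v w"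
  unfolding quad_form_def b_def sum.distrib[symmetric] coords_add
  by (intro sum.cong refl) (simp add: algebra_simps)

lemma q_scale: "q (scale v a) = q v * a * a"
  unfolding quad_form_def sum_distrib_right coords_scale
  by (intro sum.cong refl) (simp add: algebra_simps)

lemma b_commute: "b v w = b w v"
  by (simp add: b_def mult.commute add.commute)

lemma b_add_right: "b u (v + w) = b u v + b u w"
  unfolding b_def sum.distrib[symmetric] coords_add
  by (intro sum.cong refl) (simp add: algebra_simps)

lemma b_scale_right: "b u (scale v a) = b u v * a"
  unfolding b_def sum_distrib_right coords_scale
  by (intro sum.cong refl) (simp add: algebra_simps)

lemma b_zero_right [simp]: "b u 0 = 0"
  by (simp add: b_def)

lemma b_minus_right: "b u (- v) = - b u v"
  using b_add_right[of u v "- v"] by (simp add: eq_neg_iff_add_eq_0 add.commute)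

lemma b_diff_right: "b u (v - w) = b u v - b u w"
  using b_add_right[of u v "- w"] by (simp add: b_minus_right)

text \<open>Within each hyperbolic pair, pairing with one basis vector reads off the coordinate at
  its partner.\<close>

lemma b_nondegenerate:
  assumes "\<And>w. b w v = 0"
  shows "v = 0"
proof (rule eq_zero_coords)
  fix j assume j: "j \<in> {1..2 * n}"
  have *: "coord v (2 * i - 1) = 0 \<and> coord v (2 * i) = 0" if i: "i \<in> {1..n}" for i
  proof -
    have "b (E (2 * i)) v = (\<Sum>k=1..n. if k = i then coord v (2 * i - 1) else 0)"
      unfolding b_def
    proof (intro sum.cong refl)
      fix k assume "k \<in> {1..n}"
      then have "2 * k - 1 \<noteq> 2 * i" "2 * i \<in> {1..2 * n}" using i by (auto, presburger)
      then show "coord (E (2 * i)) (2 * k - 1) * coord v (2 * k)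
          + coord (E (2 * i)) (2 * k) * coord v (2 * k - 1) = (if k = i then coord v (2 * i - 1) else 0)"
        by (simp add: coords_E)
    qed
    then have 1: "b (E (2 * i)) v = coord v (2 * i - 1)" using i by simp
    have "b (E (2 * i - 1)) v = (\<Sum>k=1..n. if k = i then coord v (2 * i) else 0)"
      unfolding b_def
    proof (intro sum.cong refl)
      fix k assume k: "k \<in> {1..n}"
      then have "2 * k \<noteq> 2 * i - 1" "2 * i - 1 \<in> {1..2 * n}" "2 * k - 1 = 2 * i - 1 \<longleftrightarrow> k = i"
        using i by (auto, presburger)
      then show "coord (E (2 * i - 1)) (2 * k - 1) * coord v (2 * k)
          + coord (E (2 * i - 1)) (2 * k) * coord v (2 * k - 1) = (if k = i then coord v (2 * i) else 0)"
        by (simp add: coords_E)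
    qed
    then have "b (E (2 * i - 1)) v = coord v (2 * i)" using i by simp
    with 1 assms show ?thesis by simp
  qed
  obtain i where "j = 2 * i \<or> j = 2 * i - 1" "i \<in> {1..n}"
  proof (cases "even j")
    case True
    then show ?thesis using j that[of "j div 2"] by auto
  next
    case False
    then have "j = 2 * ((j + 1) div 2) - 1" "(j + 1) div 2 \<in> {1..n}" using j by (auto elim!: oddE)
    then show ?thesis using that by blast
  qed
  then show "coord v j = 0" using * by auto
qed

section \<open>Orthogonal complements\<close>

definition perp :: "'v set \<Rightarrow> 'v set" where
  "perp B = {v. \<forall>u\<in>B. b u v = 0}"

lemma rsubspace_perp: "rsubspace scale (perp B)"
  by (auto simp: rsubspace_def perp_def b_add_right b_scale_right)

lemma perp_antimono: "A \<subseteq> B \<Longrightarrow> perp B \<subseteq> perp A"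
  by (auto simp: perp_def)

lemma subset_perp_commute: "A \<subseteq> perp B \<longleftrightarrow> B \<subseteq> perp A"
  unfolding perp_def subset_iff mem_Collect_eq using b_commute by metis

lemma perp_rspan: "perp (rspan B) = perp B"
proof
  show "perp (rspan B) \<subseteq> perp B" using rspan_superset by (rule perp_antimono)
  have "B \<subseteq> perp (perp B)" using subset_perp_commute by blast
  then have "rspan B \<subseteq> perp (perp B)" using rspan_least rsubspace_perp by blast
  then show "perp B \<subseteq> perp (rspan B)" using subset_perp_commute by blast
qed

lemma perp_Un: "perp (A \<union> B) = perp A \<inter> perp B"
  by (auto simp: perp_def)

lemma perp_plus: "rsubspace scale U \<Longrightarrow> rsubspace scale W \<Longrightarrow> perp (U + W) = perp U \<inter> perp W"
  using perp_rspan[of "U \<union> W"] by (simp add: rspan_Un rspan_subspace perp_Un)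

lemma perp_UNIV: "perp UNIV = {0}"
  using b_nondegenerate by (auto simp: perp_def)

lemma rdim_Int_perp:
  assumes "rsubspace scale W"
  shows "rdim scale W \<le> rdim scale (W \<inter> perp {x}) + 1"
proof (cases "W \<subseteq> perp {x}")
  case True
  then show ?thesis by (simp add: Int_absorb2)
next
  case False
  then obtain y where y: "y \<in> W" "b x y \<noteq> 0" by (auto simp: perp_def)
  have sub: "rsubspace scale (W \<inter> perp {x})" using assms rsubspace_perp rsubspace_Int by blast
  have "W \<subseteq> (W \<inter> perp {x}) + rspan {y}"
  proof
    fix v assume v: "v \<in> W"
    \<comment> \<open>The multiple of \<open>y\<close> is chosen so that \<open>v - ?y\<close> is
      orthogonal to \<open>x\<close>.\<close>
    let ?y = "scale y (b x v / b x y)"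
    have "v - ?y \<in> W \<inter> perp {x}"
      using v y rsubspaceD(3,5)[OF assms] by (auto simp: perp_def b_diff_right b_scale_right)
    then have "(v - ?y) + ?y \<in> (W \<inter> perp {x}) + rspan {y}"
      by (intro set_plus_intro) (auto simp: rspan_singleton)
    then show "v \<in> (W \<inter> perp {x}) + rspan {y}" by simp
  qed
  then have "rdim scale W \<le> rdim scale ((W \<inter> perp {x}) + rspan {y})"
    using assms sub by (intro rdim_mono rsubspace_plus rsubspace_rspan)
  then show ?thesis using rdim_plus_le[OF sub, of y] by simp
qed

lemma rdim_perp_ge: "finite B \<Longrightarrow> 2 * n \<le> rdim scale (perp B) + card B"
proof (induction B rule: finite_induct)
  case empty
  have "perp {} = UNIV" by (simp add: perp_def)
  then show ?case by (simp add: rdim_UNIV)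
next
  case (insert x B)
  have "perp (insert x B) = perp B \<inter> perp {x}" using perp_Un[of "{x}" B] by auto
  then show ?case using insert rdim_Int_perp[OF rsubspace_perp, of B x] by simp
qed

text \<open>A basis \<open>B\<close> of \<open>U\<close> is extended to a basis \<open>C\<close> of
  the whole space. The complements of \<open>B\<close> and of \<open>C - B\<close> meet trivially by
  nondegeneracy, so their dimensions add up to at most \<open>2 * n\<close>; hence both lower bounds
  from \<open>rdim_perp_ge\<close> are equalities.\<close>

lemma rdim_perp:
  assumes "rsubspace scale U"
  shows "rdim scale (perp U) + rdim scale U = 2 * n"
proof -
  obtain B where B: "rbasis scale B U" "finite B" "card B = rdim scale U"
    using obtain_rbasis[OF assms] .
  then obtain C where C: "B \<subseteq> C" "rbasis scale C UNIV" "finite C"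
    using rbasis_extend[OF rsubspace_UNIV, of B] by (auto simp: rbasis_def)
  have cC: "card C = 2 * n" using rdim_eq_card[OF C(2)] rdim_UNIV by simp
  have pU: "perp U = perp B" using B(1) perp_rspan[of B] by (simp add: rbasis_def)
  have "perp B \<inter> perp (C - B) = perp C" using C(1) perp_Un[of B "C - B"] by (simp add: Un_absorb1)
  also have "\<dots> = {0}" using C(2) perp_rspan[of C] perp_UNIV by (simp add: rbasis_def)
  finally have "rdim scale (perp B + perp (C - B)) = rdim scale (perp B) + rdim scale (perp (C - B))"
    using rdim_plus_Int[OF rsubspace_perp rsubspace_perp, of B "C - B"] by (simp add: rdim_zero)
  moreover have "rdim scale (perp B + perp (C - B)) \<le> 2 * n"
    using rdim_mono[OF _ rsubspace_UNIV] rsubspace_plus rsubspace_perp rdim_UNIV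
    by (metis subset_UNIV)
  moreover have "2 * n \<le> rdim scale (perp B) + card B" "2 * n \<le> rdim scale (perp (C - B)) + card (C - B)"
    using rdim_perp_ge B(2) C(3) by auto
  ultimately show ?thesis
    using B(3) pU cC card_Diff_subset[OF B(2) C(1)] card_mono[OF C(3,1)] by simp
qed

section \<open>Totally singular subspaces\<close>

abbreviation ts :: "'v set \<Rightarrow> bool" where
  "ts \<equiv> totally_singular scale n E"

abbreviation maxts :: "'v set set" where
  "maxts \<equiv> max_singular scale n E"

lemma tsD: "ts U \<Longrightarrow> rsubspace scale U" "ts U \<Longrightarrow> v \<in> U \<Longrightarrow> q v = 0"
  by (auto simp: totally_singular_def)

lemma ts_subset: "ts W \<Longrightarrow> rsubspace scale U \<Longrightarrow> U \<subseteq> W \<Longrightarrow> ts U"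
  by (auto simp: totally_singular_def)

lemma ts_perp:
  assumes "ts U"
  shows "U \<subseteq> perp U"
proof -
  have "b u v = 0" if "u \<in> U" "v \<in> U" for u v
    using q_add[of u v] tsD[OF assms] that rsubspaceD(2)[OF tsD(1)[OF assms]] by simp
  then show ?thesis by (auto simp: perp_def)
qed

lemma ts_plus:
  assumes "ts U" "ts W" "W \<subseteq> perp U"
  shows "ts (U + W)"
  unfolding totally_singular_def
proof
  show "rsubspace scale (U + W)" using assms rsubspace_plus tsD by blast
  show "\<forall>v\<in>U + W. q v = 0"
    using assms tsD by (auto elim!: set_plus_elim simp: q_add perp_def subset_iff)
qed

lemma ts_singleton: "q x = 0 \<Longrightarrow> ts (rspan {x})"
  using rsubspace_rspan[of "{x}"] by (auto simp: totally_singular_def rspan_singleton q_scale)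

lemma maxtsD: "M \<in> maxts \<Longrightarrow> ts M" "M \<in> maxts \<Longrightarrow> rsubspace scale M" "M \<in> maxts \<Longrightarrow> rdim scale M = n"
  by (auto simp: max_singular_def totally_singular_def)

lemma maxts_perp: "M \<in> maxts \<Longrightarrow> perp M = M"
  using rsubspace_eqI[OF maxtsD(2) rsubspace_perp ts_perp, of M] maxtsD rdim_perp[of M] by force

text \<open>The projection of \<open>M\<close> onto \<open>Z\<close>. Its dimension follows from
  \<open>M \<inter> perp Z = perp (M + Z)\<close>, which holds because \<open>M\<close> is its own
  complement.\<close>

lemma maxts_project:
  assumes "ts Z" "M \<in> maxts"
  shows "Z + (M \<inter> perp Z) \<in> maxts"
proof -
  note Z = tsD(1)[OF assms(1)] and M = maxtsD[OF assms(2)]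
  have sub: "rsubspace scale (M \<inter> perp Z)" using M rsubspace_Int rsubspace_perp by blast
  have "M \<inter> perp Z = perp (M + Z)" using perp_plus[OF M(2) Z] maxts_perp[OF assms(2)] by simp
  then have "rdim scale (M \<inter> perp Z) + rdim scale (M + Z) = 2 * n"
    using rdim_perp[OF rsubspace_plus[OF M(2) Z]] by simp
  moreover have "rdim scale (M + Z) + rdim scale (M \<inter> Z) = n + rdim scale Z"
    using rdim_plus_Int[OF M(2) Z] M(3) by simp
  moreover have "Z \<inter> (M \<inter> perp Z) = M \<inter> Z" using ts_perp[OF assms(1)] by blast
  then have "rdim scale (Z + (M \<inter> perp Z)) + rdim scale (M \<inter> Z) = rdim scale Z + rdim scale (M \<inter> perp Z)"
    using rdim_plus_Int[OF Z sub] by simp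
  moreover have "ts (Z + (M \<inter> perp Z))"
    using ts_plus[OF assms(1) ts_subset[OF M(1) sub]] by simp
  ultimately show ?thesis by (simp add: max_singular_def)
qed

lemma maxts_Int_eq:
  assumes "X \<in> maxts" "Y \<in> maxts" "X \<noteq> Y" "rsubspace scale Z" "Suc (rdim scale Z) = n" "Z \<subseteq> X" "Z \<subseteq> Y"
  shows "X \<inter> Y = Z"
proof -
  have "rdim scale (X \<inter> Y) \<le> rdim scale Z"
    using rdim_Int_less[OF maxtsD(2) maxtsD(2) assms(3)] maxtsD(3) assms(1,2,5) by simp
  then have "Z = X \<inter> Y"
    using assms maxtsD(2) by (intro rsubspace_eqI rsubspace_Int) auto
  then show ?thesis ..
qed

lemma maxts_insert:
  assumes "X \<in> maxts" "rsubspace scale Z" "Suc (rdim scale Z) = n" "Z \<subseteq> X" "x \<in> X" "x \<notin> Z"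
  shows "Z + rspan {x} = X"
proof (rule rsubspace_eqI)
  show "Z + rspan {x} \<subseteq> X"
    using plus_least[OF maxtsD(2)[OF assms(1)] assms(4) rspan_least[OF maxtsD(2)[OF assms(1)]]] assms(5)
    by simp
  show "rdim scale X \<le> rdim scale (Z + rspan {x})"
    using rdim_plus_singleton[OF assms(2,6)] assms(3) maxtsD(3)[OF assms(1)] by simp
  show "rsubspace scale (Z + rspan {x})" using assms(2) rsubspace_rspan by (rule rsubspace_plus)
qed (rule maxtsD(2)[OF assms(1)])

text \<open>The quotient of \<open>perp Z\<close> by \<open>Z\<close> is a hyperbolic plane, which
  has only two singular points. In vectors: \<open>perp Z = X + Y\<close>, and \<open>x + y\<close>
  is singular only if \<open>b x y = 0\<close>, which forces \<open>x\<close> or \<open>y\<close>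
  into \<open>Z\<close>.\<close>

lemma two_maxts:
  assumes "X \<in> maxts" "Y \<in> maxts" "W \<in> maxts" "rsubspace scale Z" "Suc (rdim scale Z) = n"
    and "Z \<subseteq> X" "Z \<subseteq> Y" "Z \<subseteq> W" "X \<noteq> Y"
  shows "W = X \<or> W = Y"
proof -
  have XY: "X \<inter> Y = Z" using maxts_Int_eq assms by blast
  have perpZ: "V \<subseteq> perp Z" if "V \<in> maxts" "Z \<subseteq> V" for V
    using perp_antimono[OF that(2)] maxts_perp[OF that(1)] by simp
  have "X + Y = perp Z"
  proof (rule rsubspace_eqI)
    show "X + Y \<subseteq> perp Z" using assms perpZ by (intro plus_least rsubspace_perp) auto
    show "rdim scale (perp Z) \<le> rdim scale (X + Y)"
      using rdim_perp[OF assms(4)] rdim_plus_Int[of X Y] XY maxtsD assms by simp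
  qed (use assms maxtsD rsubspace_plus rsubspace_perp in auto)
  then have WXY: "W \<subseteq> X + Y" using perpZ assms by simp
  have "\<not> W \<subseteq> Z"
    using rdim_mono[of W Z] maxtsD(2,3)[OF assms(3)] assms(4,5) by auto
  then obtain w where w: "w \<in> W" "w \<notin> Z" by blast
  obtain x y where xy: "w = x + y" "x \<in> X" "y \<in> Y" using WXY w(1) by (auto elim!: set_plus_elim)
  have "q w = 0" "q x = 0" "q y = 0" using tsD(2) maxtsD(1) assms w xy by blast+
  then have bxy: "b x y = 0" using xy(1) q_add[of x y] by simp
  have "x \<in> Z \<or> y \<in> Z"
  proof (rule ccontr)
    assume *: "\<not> (x \<in> Z \<or> y \<in> Z)"
    \<comment> \<open>With \<open>x\<close> outside \<open>Z\<close>, the vectors orthogonal to both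
      \<open>Z\<close> and \<open>x\<close> form \<open>X\<close>; since \<open>y\<close> is one of
      them, it lies in \<open>X \<inter> Y = Z\<close>.\<close>
    then have "perp (Z + rspan {x}) = X"
      using maxts_insert[of X Z x] maxts_perp assms xy by simp
    then have "perp Z \<inter> perp {x} = X"
      using perp_plus[OF assms(4) rsubspace_rspan, of "{x}"] by (simp add: perp_rspan)
    moreover have "y \<in> perp Z" using perpZ[OF assms(2,7)] xy by blast
    moreover have "y \<in> perp {x}" using bxy by (simp add: perp_def)
    ultimately show False using * XY xy by blast
  qed
  then have "w \<in> X \<or> w \<in> Y"
    using xy assms rsubspaceD(2)[OF maxtsD(2)] by blast
  then show ?thesis
    using maxts_Int_eq[of W X Z] maxts_Int_eq[of W Y Z] assms w by blast
qed

text \<open>The projection of \<open>M\<close> onto \<open>Z = X \<inter> Y\<close> is a maximal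
  subspace through \<open>Z\<close>, hence \<open>X\<close> or \<open>Y\<close>. The one that it
  equals meets \<open>M\<close> in exactly one dimension more than the other. This is what separates
  the two classes.\<close>

lemma adjacent_parity:
  assumes "X \<in> maxts" "Y \<in> maxts" "M \<in> maxts" "Suc (rdim scale (X \<inter> Y)) = n"
  shows "even (rdim scale (X \<inter> M)) \<longleftrightarrow> odd (rdim scale (Y \<inter> M))"
proof -
  define Z where "Z = X \<inter> Y"
  have subZ: "rsubspace scale Z" using assms maxtsD rsubspace_Int unfolding Z_def by blast
  have tsZ: "ts Z" using ts_subset[OF maxtsD(1)[OF assms(1)] subZ] by (simp add: Z_def)
  have dimZ: "Suc (rdim scale Z) = n" using assms(4) by (simp add: Z_def)
  have "X \<noteq> Y" using assms(4) maxtsD(3)[OF assms(1)] by auto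
  let ?M = "Z + (M \<inter> perp Z)"
  have M: "?M \<in> maxts" using maxts_project[OF tsZ assms(3)] .
  have subM: "rsubspace scale (M \<inter> perp Z)" using maxtsD assms rsubspace_perp rsubspace_Int by blast
  have step: "rdim scale (V \<inter> M) = rdim scale (V' \<inter> M) + 1"
    if V: "V \<in> maxts" "V' \<in> maxts" "V \<inter> V' = Z" "?M = V" for V V'
  proof -
    have in_perp: "V \<subseteq> perp Z" "V' \<subseteq> perp Z"
      using perp_antimono[of Z V] perp_antimono[of Z V'] maxts_perp V by auto
    have "M \<inter> perp Z \<subseteq> V" using subset_plus_right[OF subZ, of "M \<inter> perp Z"] V(4) by simp
    then have 1: "V \<inter> M = M \<inter> perp Z" "V' \<inter> M = M \<inter> Z" using in_perp V(3) by auto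
    have "Z \<inter> (M \<inter> perp Z) = M \<inter> Z" using ts_perp[OF tsZ] by blast
    then have "n + rdim scale (M \<inter> Z) = rdim scale Z + rdim scale (M \<inter> perp Z)"
      using rdim_plus_Int[OF subZ subM] maxtsD(3)[OF M] by simp
    then show ?thesis using 1 dimZ by simp
  qed
  have "?M = X \<or> ?M = Y"
  proof (rule two_maxts[OF assms(1,2) M subZ dimZ])
    show "Z \<subseteq> ?M" by (rule subset_plus_left[OF subM])
  qed (use Z_def \<open>X \<noteq> Y\<close> in auto)
  then show ?thesis
    using step[of X Y] step[of Y X] assms Z_def by (auto simp: Int_commute)
qed

section \<open>Rational totally singular subspaces\<close>

lemma left_linear_sum:
  "left_linear K \<phi> \<Longrightarrow> \<phi> (\<Sum>i\<in>I. f i) = (\<Sum>i\<in>I. \<phi> (f i))"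
  by (induction I rule: infinite_finite_induct) (auto simp: left_linear_zero, simp add: left_linear_def)

text \<open>For rational \<open>u\<close> the functional \<open>b u\<close> has its coefficients in
  \<open>K\<close>, so it commutes with left linear maps applied coordinatewise.\<close>

lemma rat_perp:
  assumes "rat U"
  shows "rat (perp U)"
proof (rule ratI[OF rsubspace_perp])
  fix \<phi> v assume phi: "left_linear K \<phi>" and v: "v \<in> perp U"
  have "b u (coordwise \<phi> v) = 0" if u: "u \<in> U \<inter> ratvec" for u
  proof -
    have hom: "\<phi> (k * x) = k * \<phi> x" if "k \<in> K" for k x using phi that by (auto simp: left_linear_def)
    have add: "\<phi> (x + y) = \<phi> x + \<phi> y" for x y using phi by (auto simp: left_linear_def)
    have uK: "coord u i \<in> K" for i using u by (simp add: ratvec_def)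
    have "b u (coordwise \<phi> v) = \<phi> (b u v)"
      unfolding b_def by (simp add: left_linear_sum[OF phi] add hom uK coords_coordwise[OF phi])
    then show ?thesis using u v left_linear_zero[OF phi] by (simp add: perp_def)
  qed
  then have "coordwise \<phi> v \<in> perp (U \<inter> ratvec)" by (simp add: perp_def)
  then show "coordwise \<phi> v \<in> perp U" using perp_rspan[of "U \<inter> ratvec"] ratD(2)[OF assms] by simp
qed

text \<open>The reference subspace in \<open>S_plus\<close>. It serves both to tell the classes
  apart and as a rational maximal subspace from which others are projected.\<close>

definition M_odd :: "'v set" where
  "M_odd = rspan ((\<lambda>i. E (2 * i - 1)) ` {1..n})"

lemma E_ratvec: "i \<in> {1..2 * n} \<Longrightarrow> E i \<in> ratvec"
  by (auto simp: ratvec_def coords_E sub_division_ringD[OF sub_K])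

lemma rat_M_odd: "rat M_odd"
  unfolding M_odd_def
proof (rule rat_rspan)
  show "(\<lambda>i. E (2 * i - 1)) ` {1..n} \<subseteq> ratvec"
  proof (rule image_subsetI)
    fix i assume "i \<in> {1..n}"
    then have "2 * i - 1 \<in> {1..2 * n}" by auto
    then show "E (2 * i - 1) \<in> ratvec" by (rule E_ratvec)
  qed
qed

lemma M_odd_maxts: "M_odd \<in> maxts"
proof -
  have mem: "2 * i - 1 \<in> {1..2 * n}" if "i \<in> {1..n}" for i using that by auto
  have "rdim scale M_odd = card {1..n}"
    unfolding M_odd_def
    by (rule rdim_pivots[where p = "\<lambda>i. 2 * i - 1"]) (use mem in \<open>auto simp: coords_E simp del: atLeastAtMost_iff\<close>)
  moreover have "M_odd \<subseteq> {v. \<forall>i\<in>{1..n}. coord v (2 * i) = 0}"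
    unfolding M_odd_def
  proof (rule rspan_least)
    show "rsubspace scale {v. \<forall>i\<in>{1..n}. coord v (2 * i) = 0}"
      by (auto simp: rsubspace_def coords_add coords_scale)
    have "coord (E (2 * i - 1)) (2 * j) = 0" if "i \<in> {1..n}" "j \<in> {1..n}" for i j
      using coords_E[OF mem[OF that(1)], of "2 * j"] that by (auto split: if_splits) presburger
    then show "(\<lambda>i. E (2 * i - 1)) ` {1..n} \<subseteq> {v. \<forall>i\<in>{1..n}. coord v (2 * i) = 0}" by blast
  qed
  then have "\<forall>v\<in>M_odd. q v = 0" by (auto simp: quad_form_def intro!: sum.neutral)
  ultimately show ?thesis
    using rsubspace_rspan by (simp add: max_singular_def totally_singular_def M_odd_def)
qed

text \<open>Of the two maximal totally singular subspaces through \<open>U\<close>, the projection \<open>N\<close> of \<open>M_odd\<close> is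
  rational; the other one is spanned by \<open>U\<close> and the second singular point of a rational line
  that meets \<open>N\<close> outside \<open>U\<close>.\<close>

lemma rat_maxts:
  assumes "rat U" "Suc (rdim scale U) = n" "U \<subseteq> M" "M \<in> maxts"
  shows "rat M"
proof -
  note subU = ratD(1)[OF assms(1)]
  have tsU: "ts U" using ts_subset[OF maxtsD(1)] assms subU by blast
  define N where "N = U + (M_odd \<inter> perp U)"
  have N: "N \<in> maxts" unfolding N_def by (rule maxts_project[OF tsU M_odd_maxts])
  have UN: "U \<subseteq> N" unfolding N_def
    by (rule subset_plus_left) (use rsubspace_Int maxtsD M_odd_maxts rsubspace_perp in blast)
  have ratN: "rat N" unfolding N_def
    by (rule rat_plus[OF assms(1) rat_Int[OF rat_M_odd rat_perp[OF assms(1)]]])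
  show ?thesis
  proof (cases "M = N")
    case True
    then show ?thesis using ratN by simp
  next
    case False
    have "\<not> N \<inter> ratvec \<subseteq> U"
    proof
      assume "N \<inter> ratvec \<subseteq> U"
      then have "N \<subseteq> U" using rspan_least[OF subU] ratD(2)[OF ratN] by blast
      then show False using rdim_mono[OF maxtsD(2)[OF N] subU] maxtsD(3)[OF N] assms(2) by simp
    qed
    then obtain x where x: "x \<in> N" "x \<in> ratvec" "x \<notin> U" by blast
    \<comment> \<open>Otherwise \<open>perp U\<close>, of dimension \<open>n + 1\<close>, would
      coincide with \<open>N\<close>, of dimension \<open>n\<close>.\<close>
    have "\<not> perp U \<inter> ratvec \<subseteq> perp {x}"
    proof
      assume "perp U \<inter> ratvec \<subseteq> perp {x}"
      then have "perp U \<subseteq> perp {x}"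
        using rspan_least[OF rsubspace_perp] ratD(2)[OF rat_perp[OF assms(1)]] by blast
      then have "perp U = perp (U + rspan {x})"
        using perp_plus[OF subU rsubspace_rspan, of "{x}"] perp_rspan[of "{x}"] by blast
      also have "\<dots> = N" using maxts_insert[OF N subU assms(2) UN x(1,3)] maxts_perp[OF N] by simp
      finally show False using rdim_perp[OF subU] maxtsD(3)[OF N] assms(2) by simp
    qed
    then obtain y where y: "y \<in> perp U" "y \<in> ratvec" "b x y \<noteq> 0" by (auto simp: perp_def)
    have qK: "q y \<in> K" and bK: "b x y \<in> K"
      unfolding quad_form_def b_def
      by (intro sub_division_ring_sum[OF sub_K] sub_division_ringD(4,7)[OF sub_K];
        use x(2) y(2) in \<open>simp add: ratvec_def\<close>)+
    \<comment> \<open>As \<open>q x = 0\<close>, the value of \<open>q\<close> on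
      \<open>y + scale x c\<close> is \<open>q y + b x y * c\<close>, linear in \<open>c\<close>;
      this is its root, and it lies in \<open>K\<close>.\<close>
    define c where "c = - (q y * inverse (b x y))"
    define z where "z = y + scale x c"
    have cK: "c \<in> K" unfolding c_def
      by (intro sub_division_ringD(4-6)[OF sub_K] qK bK)
    have z_rat: "z \<in> ratvec"
      using x(2) y(2) cK by (simp add: ratvec_def z_def coords_add coords_scale sub_division_ringD(4,7)[OF sub_K])
    have qx: "q x = 0" using tsD(2)[OF maxtsD(1)[OF N] x(1)] .
    have "b y x = b x y" by (rule b_commute)
    then have qz: "q z = 0" using qx y(3) by (simp add: z_def c_def q_add q_scale b_scale_right)
    have "b x x = 0" using ts_perp[OF maxtsD(1)[OF N]] x(1) by (auto simp: perp_def)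
    then have "b x z \<noteq> 0" using y(3) by (simp add: z_def b_add_right b_scale_right)
    then have zN: "z \<notin> N" using ts_perp[OF maxtsD(1)[OF N]] x(1) by (auto simp: perp_def)
    have "x \<in> perp U" using perp_antimono[OF UN] maxts_perp[OF N] x(1) by blast
    then have "z \<in> perp U" unfolding z_def using y(1) rsubspaceD(2,3)[OF rsubspace_perp] by blast
    then have "rspan {z} \<subseteq> perp U" using rspan_least[OF rsubspace_perp] by blast
    then have "ts (U + rspan {z})" using ts_plus[OF tsU ts_singleton[OF qz]] by blast
    moreover have "rdim scale (U + rspan {z}) = n"
      using rdim_plus_singleton[OF subU, of z] zN UN assms(2) by auto
    ultimately have W: "U + rspan {z} \<in> maxts" by (simp add: max_singular_def)
    have "z \<in> U + rspan {z}" using subset_plus_right[OF subU] rspan_superset by blast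
    then have "N \<noteq> U + rspan {z}" using zN by blast
    then have "M = U + rspan {z}"
      using two_maxts[OF N W assms(4) subU assms(2) UN subset_plus_left[OF rsubspace_rspan] assms(3)] False
      by blast
    then show ?thesis using rat_plus[OF assms(1) rat_rspan[of "{z}"]] z_rat by simp
  qed
qed

text \<open>Closure along lines forces the first two disjuncts: two different witnesses inside one
  \<open>Y\<close> can make \<open>Y\<close> rational, and then the other positions of
  \<open>X\<close> need not share any witness.\<close>

definition linked :: "'v set \<Rightarrow> 'v set \<Rightarrow> bool" where
  "linked X Y \<longleftrightarrow> rat X \<or> rat Y \<or> (\<exists>Z. rat Z \<and> Z \<subseteq> X \<inter> Y \<and> n \<le> rdim scale Z + 2)"

lemma linked_commute: "linked X Y \<longleftrightarrow> linked Y X"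
  by (auto simp: linked_def Int_commute)

text \<open>Unless \<open>Y\<close> is rational, every combination of the disjuncts for
  \<open>X1\<close> and \<open>X2\<close> turns out to make \<open>L = X1 \<inter> X2\<close>
  rational, and \<open>L\<close> lies in all positions.\<close>

lemma linked_line:
  assumes max: "X1 \<in> maxts" "X2 \<in> maxts" "Y \<in> maxts"
    and adj: "Suc (rdim scale (X1 \<inter> Y)) = n" "Suc (rdim scale (X2 \<inter> Y)) = n"
    and X12: "rdim scale (X1 \<inter> X2) + 2 = n"
    and L: "rsubspace scale L" "rdim scale L + 2 = n" "L \<subseteq> X1" "L \<subseteq> X2" "L \<subseteq> X" "L \<subseteq> Y"
    and linked: "linked X1 Y" "linked X2 Y"
  shows "linked X Y"
proof (cases "rat Y")
  case True
  then show ?thesis by (simp add: linked_def)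
next
  case nrat: False
  have X12L: "X1 \<inter> X2 = L"
    using rsubspace_eqI[of L "X1 \<inter> X2"] L X12 rsubspace_Int maxtsD max by auto
  have goal: ?thesis if "rat L"
    using that L by (auto simp: linked_def intro!: exI[of _ L])
  \<comment> \<open>A rational subspace of \<open>Y\<close> of dimension \<open>n - 1\<close> or
    \<open>n\<close> would make \<open>Y\<close> rational, the first by
    \<open>rat_maxts\<close>.\<close>
  have small: "rdim scale Z + 2 \<le> n" if "rat Z" "Z \<subseteq> Y" for Z
  proof (rule ccontr)
    assume "\<not> rdim scale Z + 2 \<le> n"
    then consider "n \<le> rdim scale Z" | "Suc (rdim scale Z) = n" by linarith
    then show False
    proof cases
      case 1
      then have "Z = Y" using rsubspace_eqI[of Z Y] ratD that maxtsD max by simp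
      then show False using that nrat by simp
    next
      case 2
      then show False using rat_maxts that nrat max by blast
    qed
  qed
  \<comment> \<open>One position is rational, the other has a witness \<open>Z\<close>. If
    \<open>Z\<close> were not inside the rational one, then \<open>X \<inter> perp Z\<close> would
    be rational and equal to \<open>X \<inter> Y\<close>, too large for a rational subspace of
    \<open>Y\<close>.\<close>
  have mixed: "rat L"
    if "rat X" "rat Z" "Z \<subseteq> X' \<inter> Y" "n \<le> rdim scale Z + 2" "X \<in> maxts" "Suc (rdim scale (X \<inter> Y)) = n"
      "X \<inter> X' = L"
    for X X' Z
  proof -
    have dimZ: "rdim scale Z + 2 = n" using small[OF that(2)] that(3,4) by simp
    note subZ = ratD(1)[OF that(2)]
    have "Z \<subseteq> X"
    proof (rule ccontr)
      assume "\<not> Z \<subseteq> X"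
      have "X \<inter> perp Z \<noteq> X"
      proof
        assume "X \<inter> perp Z = X"
        then have "Z \<subseteq> perp X" using subset_perp_commute by blast
        then show False using \<open>\<not> Z \<subseteq> X\<close> maxts_perp[OF that(5)] by simp
      qed
      then have "rdim scale (X \<inter> perp Z) < n"
        using rdim_strict_mono[of "X \<inter> perp Z" X] maxtsD[OF that(5)] rsubspace_Int rsubspace_perp by auto
      moreover have "Y \<subseteq> perp Z"
        using perp_antimono[of Z Y] that(3) maxts_perp[OF max(3)] by auto
      ultimately have "X \<inter> Y = X \<inter> perp Z"
        using rsubspace_eqI[of "X \<inter> Y" "X \<inter> perp Z"] maxtsD(2) max that(5,6) rsubspace_Int rsubspace_perp
        by auto
      then have "rat (X \<inter> Y)" using rat_Int[OF that(1) rat_perp[OF that(2)]] by simp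
      then show False using small[of "X \<inter> Y"] that(6) by simp
    qed
    then have "Z \<subseteq> L" using that(3,7) by blast
    then have "Z = L" using rsubspace_eqI[OF subZ L(1)] dimZ L(2) by simp
    then show ?thesis using that(2) by simp
  qed
  consider "rat X1" "rat X2"
    | Z where "rat X1" "rat Z" "Z \<subseteq> X2 \<inter> Y" "n \<le> rdim scale Z + 2"
    | Z where "rat X2" "rat Z" "Z \<subseteq> X1 \<inter> Y" "n \<le> rdim scale Z + 2"
    | Z1 Z2 where "rat Z1" "Z1 \<subseteq> X1 \<inter> Y" "n \<le> rdim scale Z1 + 2"
        "rat Z2" "Z2 \<subseteq> X2 \<inter> Y" "n \<le> rdim scale Z2 + 2"
    using linked nrat unfolding linked_def by blast
  then show ?thesis
  proof cases
    case 1
    then show ?thesis using goal rat_Int X12L by metis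
  next
    case 2
    then show ?thesis using goal mixed[of X1 Z X2] max adj X12L by blast
  next
    case 3
    then show ?thesis using goal mixed[of X2 Z X1] max adj X12L by (metis Int_commute)
  next
    case 4
    \<comment> \<open>Both witnesses have dimension at least \<open>n - 2\<close> and their sum at
      most that, so they agree and lie in \<open>X1 \<inter> X2\<close>.\<close>
    have "Z1 + Z2 \<subseteq> Y" using 4 maxtsD(2)[OF max(3)] by (intro plus_least) auto
    then have "rdim scale (Z1 + Z2) + 2 \<le> n" using small rat_plus 4 by blast
    moreover have "rsubspace scale (Z1 + Z2)" "rsubspace scale Z1" "rsubspace scale Z2"
      using ratD(1) rat_plus 4 by auto
    moreover have "Z1 \<subseteq> Z1 + Z2" "Z2 \<subseteq> Z1 + Z2"
      using subset_plus_left subset_plus_right calculation by auto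
    ultimately have "Z1 = Z1 + Z2" "Z2 = Z1 + Z2"
      using 4 rsubspace_eqI[of Z1 "Z1 + Z2"] rsubspace_eqI[of Z2 "Z1 + Z2"] by auto
    then have "Z1 = Z2" by simp
    then have "Z1 \<subseteq> L" using 4 X12L by blast
    then have "Z1 = L" using rsubspace_eqI[of Z1 L] ratD(1) 4 L by simp
    then show ?thesis using goal 4 by simp
  qed
qed

end

section \<open>Type D\<close>

locale D_space = hyperbolic_space +
  assumes n3: "3 \<le> n"
begin

abbreviation G :: "('a set, D_node) diagram_geometry" where
  "G \<equiv> D_building scale n E"

lemma S_plus_iff: "X \<in> S_plus scale n E \<longleftrightarrow> X \<in> maxts \<and> even (n - rdim scale (X \<inter> M_odd))"
  using maxtsD(3) by (auto simp: S_plus_def same_class_def M_odd_def)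

lemma elements_iff: "X \<in> elements G \<longleftrightarrow> ts X \<and> rdim scale X \<in> {1..n - 2} \<or> X \<in> maxts"
  by (auto simp: D_building_def S_minus_def S_plus_def)

lemma type_of_maxts: "X \<in> maxts \<Longrightarrow> type_of G X = (if even (n - rdim scale (X \<inter> M_odd)) then Plus else Minus)"
  by (simp add: D_building_def S_minus_def S_plus_iff)

lemma type_of_small: "rdim scale X \<noteq> n \<Longrightarrow> type_of G X = Dim (rdim scale X)"
  using maxtsD(3)[of X] by (auto simp: D_building_def S_minus_def S_plus_iff)

lemma type_of_DimD:
  assumes "X \<in> elements G" "type_of G X = Dim i"
  shows "ts X" "rsubspace scale X" "rdim scale X = i" "1 \<le> i" "i \<le> n - 2"
proof -
  have "X \<notin> maxts" using type_of_maxts[of X] assms(2) by (auto split: if_splits)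
  then have *: "ts X" "rdim scale X \<in> {1..n - 2}" using assms(1) by (auto simp: elements_iff)
  then have "rdim scale X \<noteq> n" using n3 by auto
  then have "rdim scale X = i" using type_of_small[of X] assms(2) by simp
  then show "ts X" "rsubspace scale X" "rdim scale X = i" "1 \<le> i" "i \<le> n - 2"
    using * tsD(1) by auto
qed

lemma type_of_signD:
  assumes "X \<in> elements G" "type_of G X = Plus \<or> type_of G X = Minus"
  shows "X \<in> maxts"
proof (rule ccontr)
  assume "X \<notin> maxts"
  then have "rdim scale X \<noteq> n" using assms(1) n3 by (auto simp: elements_iff)
  then show False using type_of_small[of X] assms(2) by simp
qed

lemma elements_rsubspace: "X \<in> elements G \<Longrightarrow> rsubspace scale X"
  using maxtsD(2) tsD(1) by (auto simp: elements_iff)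

text \<open>Singles out the pairs of types for which incidence is not inclusion.\<close>

definition opposite :: "D_node \<Rightarrow> D_node \<Rightarrow> bool" where
  "opposite s t \<longleftrightarrow> s = Plus \<and> t = Minus \<or> s = Minus \<and> t = Plus"

lemma type_of_sign_iff:
  "type_of G X = Plus \<longleftrightarrow> X \<in> S_plus scale n E" "type_of G X = Minus \<longleftrightarrow> X \<in> S_minus scale n E"
  by (simp_all add: D_building_def S_minus_def)

lemma incident_iff:
  "incident G X Y \<longleftrightarrow>
    (if opposite (type_of G X) (type_of G Y) then rdim scale (X \<inter> Y) = n - 1 else X \<subseteq> Y \<or> Y \<subseteq> X)"
  unfolding opposite_def type_of_sign_iff by (simp add: D_building_def)

lemma incident_opposite:
  "opposite (type_of G X) (type_of G Y) \<Longrightarrow> incident G X Y \<longleftrightarrow> Suc (rdim scale (X \<inter> Y)) = n"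
  using n3 by (simp add: incident_iff) arith

lemma incident_subset:
  "\<not> opposite (type_of G X) (type_of G Y) \<Longrightarrow> incident G X Y \<longleftrightarrow> X \<subseteq> Y \<or> Y \<subseteq> X"
  by (simp add: incident_iff)

lemma opposite_simps [simp]: "\<not> opposite (Dim i) t" "\<not> opposite t (Dim i)" "\<not> opposite t t"
  by (auto simp: opposite_def)

lemma incident_refl: "incident G X X"
  by (simp add: incident_subset)

lemma incident_below:
  assumes "X \<in> elements G" "Y \<in> elements G" "incident G X Y \<or> incident G Y X" "type_of G X = Dim i" "i \<le> rdim scale Y"
  shows "X \<subseteq> Y"
proof -
  have "X \<subseteq> Y \<or> Y \<subseteq> X" using assms(3,4) by (auto simp: incident_subset)
  then show ?thesis
    using rsubspace_eqI[of Y X] elements_rsubspace[OF assms(1)] elements_rsubspace[OF assms(2)]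
      type_of_DimD(3)[OF assms(1,4)] assms(5) by auto
qed

lemma incident_same_type:
  assumes "X \<in> elements G" "Y \<in> elements G" "incident G X Y" "type_of G X = type_of G Y"
  shows "X = Y"
proof -
  have "rdim scale X = rdim scale Y"
  proof (cases "type_of G X")
    case (Dim i)
    then show ?thesis using type_of_DimD(3)[OF assms(1)] type_of_DimD(3)[OF assms(2)] assms(4) by simp
  qed (use type_of_signD[OF assms(1)] type_of_signD[OF assms(2)] maxtsD(3) assms(4) in auto)
  moreover have "X \<subseteq> Y \<or> Y \<subseteq> X" using assms(3,4) by (auto simp: incident_subset)
  ultimately show ?thesis
    using rsubspace_eqI[of X Y] rsubspace_eqI[of Y X] elements_rsubspace[OF assms(1)]
      elements_rsubspace[OF assms(2)] by auto
qed

lemma opposite_types: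
  assumes "X \<in> maxts" "Y \<in> maxts" "Suc (rdim scale (X \<inter> Y)) = n"
  shows "type_of G X \<noteq> type_of G Y"
proof -
  \<comment> \<open>Without this bound the natural subtraction in \<open>type_of_maxts\<close> could
    truncate and lose the parity.\<close>
  have "rdim scale (V \<inter> M_odd) \<le> n" if "V \<in> maxts" for V
    using rdim_mono[of "V \<inter> M_odd" V] maxtsD[OF that] maxtsD(2)[OF M_odd_maxts] rsubspace_Int by auto
  then have "rdim scale (X \<inter> M_odd) \<le> n" "rdim scale (Y \<inter> M_odd) \<le> n" using assms by auto
  then show ?thesis
    using adjacent_parity[OF assms(1,2) M_odd_maxts assms(3)]
    by (simp add: type_of_maxts[OF assms(1)] type_of_maxts[OF assms(2)])
qed

text \<open>Meeting in dimension \<open>n - 1\<close> would force opposite types, so the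
  intersection drops by at least two.\<close>

lemma same_type_Int:
  assumes "X \<in> maxts" "Y \<in> maxts" "type_of G X = type_of G Y" "X \<noteq> Y"
  shows "rdim scale (X \<inter> Y) + 2 \<le> n"
proof -
  have "rdim scale (X \<inter> Y) < n"
    using rdim_Int_less[OF maxtsD(2)[OF assms(1)] maxtsD(2)[OF assms(2)] assms(4)]
      maxtsD(3)[OF assms(1)] maxtsD(3)[OF assms(2)] by simp
  moreover have "Suc (rdim scale (X \<inter> Y)) \<noteq> n"
    using opposite_types[OF assms(1,2)] assms(3) by blast
  ultimately show ?thesis by linarith
qed

lemma nodes_G: "nodes G = Dim ` {1..n - 2} \<union> {Plus, Minus}"
  by (simp add: D_building_def)

lemma fr_Dim:
  "1 \<le> i \<Longrightarrow> i < n - 2 \<Longrightarrow> Dim (i + 1) \<in> fr G (Dim i)"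
  "1 < i \<Longrightarrow> i \<le> n - 2 \<Longrightarrow> Dim (i - 1) \<in> fr G (Dim i)"
  "Plus \<in> fr G (Dim (n - 2))" "Minus \<in> fr G (Dim (n - 2))"
  "Dim (n - 2) \<in> fr G Plus" "Dim (n - 2) \<in> fr G Minus"
  using n3 by (auto simp: fr_def D_building_def intro!: imageI)

text \<open>The generators of the plane use coordinates 1, 3 and 4, 2, one from each hyperbolic
  pair, so both are singular; they are orthogonal because the mixed terms \<open>- a\<close> and
  \<open>a\<close> cancel. Every rational vector of a maximal member has zero coordinates 1 and
  4.\<close>

lemma ex_chamber:
  assumes a: "a \<notin> K"
  shows "\<exists>C. flag G C \<and> type_of G ` C = nodes G \<and> (\<forall>X\<in>C. \<forall>Y\<in>C. \<not> between X Y \<and>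
    (type_of G X = Plus \<longrightarrow> type_of G Y = Minus \<longrightarrow> \<not> linked X Y))"
proof -
  \<comment> \<open>The pair \<open>E 5\<close>, \<open>E 6\<close> is saved for position
    \<open>n\<close>, where its two vectors complete the same \<open>F (n - 1)\<close> to the two
    maximal members; positions strictly between 2 and \<open>n\<close> take \<open>E 7\<close>,
    \<open>E 9\<close>, and so on.\<close>
  define W where "W s i = (if i = 1 then E 1 + scale (E 3) a
    else if i = 2 then E 4 - scale (E 2) a else if i = n then E s else E (2 * i + 1))" for s i
  define p where "p s i = (if i = 1 then 1 else if i = 2 then 4 else if i = n then s else 2 * i + 1)" for s i
  define F where "F k = rspan (W 5 ` {1..k})" for k
  define A where "A s = rspan (W s ` {1..n})" for s
  have W1: "coord (W s 1) l = (if l = 1 then 1 else if l = 3 then a else 0)" for s l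
  proof -
    have "1 \<in> {1..2 * n}" "3 \<in> {1..2 * n}" using n3 by auto
    from this[THEN coords_E, of l] show ?thesis by (simp add: W_def coords_add coords_scale)
  qed
  have W2: "coord (W s 2) l = (if l = 4 then 1 else if l = 2 then - a else 0)" for s l
  proof -
    have "2 \<in> {1..2 * n}" "4 \<in> {1..2 * n}" using n3 by auto
    from this[THEN coords_E, of l] show ?thesis by (simp add: W_def coords_diff coords_scale)
  qed
  have W3: "coord (W s i) l = (if l = p s i then 1 else 0)" if "s = 5 \<or> s = 6" "3 \<le> i" "i \<le> n" for s i l
  proof -
    have "p s i \<in> {1..2 * n}" "W s i = E (p s i)" using that n3 by (auto simp: W_def p_def)
    then show ?thesis using coords_E by simp
  qed
  have p12: "p s 1 = 1" "p s 2 = 4" for s by (auto simp: p_def)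
  have p3: "5 \<le> p s i" if "s = 5 \<or> s = 6" "3 \<le> i" for s i
    using that by (auto simp: p_def)
  have p_inj: "p s i = p s j \<longleftrightarrow> i = j" if "s = 5 \<or> s = 6" "3 \<le> i" "i \<le> n" "3 \<le> j" "j \<le> n" for s i j
    using that by (auto simp: p_def) presburger+
  have split_index: "i = 1 \<or> i = 2 \<or> 3 \<le> i \<and> i \<le> n" if "i \<in> {1..n}" for i
    using that by auto
  have piv: "coord (W s i) (p s j) = (if i = j then 1 else 0)"
    if s: "s = 5 \<or> s = 6" and ij: "i \<in> {1..n}" "j \<in> {1..n}" for s i j
    using split_index[OF ij(1)]
  proof (elim disjE conjE)
    assume i: "i = 1"
    show ?thesis using split_index[OF ij(2)] p3[OF s, of j] p12[of s] unfolding i W1 by auto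
  next
    assume i: "i = 2"
    show ?thesis using split_index[OF ij(2)] p3[OF s, of j] p12[of s] unfolding i W2 by auto
  next
    assume i: "3 \<le> i" "i \<le> n"
    show ?thesis
      using split_index[OF ij(2)] p3[OF s i(1)] p12[of s] p_inj[OF s i, of j] unfolding W3[OF s i] by auto
  qed
  have W5: "W s ` {1..k} = W 5 ` {1..k}" if "k < n" for s k
    using that by (intro image_cong) (auto simp: W_def)
  have subF: "rsubspace scale (F k)" and subA: "rsubspace scale (A s)" for k s
    by (simp_all add: F_def A_def rsubspace_rspan)
  have dimF: "rdim scale (F k) = k" if "k \<le> n" for k
    unfolding F_def using rdim_pivots[of "{1..k}" "W 5" "p 5"] piv that by simp
  have dimA: "rdim scale (A s) = n" if "s = 5 \<or> s = 6" for s
    unfolding A_def using rdim_pivots[of "{1..n}" "W s" "p s"] piv that by simp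
  have monoF: "F k \<subseteq> F l" if "k \<le> l" for k l
    unfolding F_def using that by (intro rspan_mono image_mono) auto
  have FA: "F k \<subseteq> A s" if "k < n" for k s
    unfolding F_def A_def W5[OF that, of s, symmetric] using that by (intro rspan_mono image_mono) auto
  \<comment> \<open>The first two equations express orthogonality to the two generators of the
    plane; \<open>11 - s\<close> is the partner of \<open>s\<close> in the pair 5, 6.\<close>
  let ?T = "\<lambda>s. {v. coord v 3 = a * coord v 1 \<and> coord v 2 = - (a * coord v 4) \<and> coord v (11 - s) = 0 \<and>
    (\<forall>i\<in>{4..n}. coord v (2 * i) = 0)}"
  have AT: "A s \<subseteq> ?T s" if s: "s = 5 \<or> s = 6" for s
    unfolding A_def
  proof (rule rspan_least)
    show "rsubspace scale (?T s)"
      by (auto simp: rsubspace_def coords_add coords_scale distrib_left mult.assoc)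
    show "W s ` {1..n} \<subseteq> ?T s"
    proof (rule image_subsetI)
      fix i assume i: "i \<in> {1..n}"
      from split_index[OF i] show "W s i \<in> ?T s"
      proof (elim disjE conjE)
        assume i: "i = 1"
        show ?thesis unfolding i mem_Collect_eq W1 using s by auto
      next
        assume i: "i = 2"
        show ?thesis unfolding i mem_Collect_eq W2 using s by auto
      next
        assume i: "3 \<le> i" "i \<le> n"
        have "p s i \<noteq> 11 - s" "\<forall>j\<in>{4..n}. p s i \<noteq> 2 * j"
          using s i by (auto simp: p_def) presburger+
        then show ?thesis unfolding mem_Collect_eq W3[OF s i] using p3[OF s i(1)] by auto
      qed
    qed
  qed
  have maxA: "A s \<in> maxts" if s: "s = 5 \<or> s = 6" for s
  proof -
    have "q v = 0" if "v \<in> A s" for v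
    proof -
      have v: "coord v 3 = a * coord v 1" "coord v 2 = - (a * coord v 4)" "coord v (11 - s) = 0"
        "\<And>i. i \<in> {4..n} \<Longrightarrow> coord v (2 * i) = 0"
        using AT[OF s] \<open>v \<in> A s\<close> by auto
      let ?f = "\<lambda>i. coord v (2 * i - 1) * coord v (2 * i)"
      have "{1..n} = {1, 2, 3} \<union> {4..n}" using n3 by auto
      then have "q v = sum ?f ({1, 2, 3} \<union> {4..n})" by (simp add: quad_form_def)
      also have "\<dots> = sum ?f {1, 2, 3} + sum ?f {4..n}" by (intro sum.union_disjoint) auto
      also have "sum ?f {4..n} = 0" using v(4) by (intro sum.neutral) auto
      also have "sum ?f {1, 2, 3} = coord v 1 * coord v 2 + coord v 3 * coord v 4 + coord v 5 * coord v 6"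
        by (simp add: add.assoc numeral_2_eq_2[symmetric])
      also have "\<dots> = 0" unfolding v(1,2) using v(3) s by (auto simp: mult_ac)
      finally show ?thesis by simp
    qed
    then show ?thesis using subA dimA[OF s] by (simp add: max_singular_def totally_singular_def)
  qed
  have A56: "A 5 \<noteq> A 6"
  proof
    assume eq: "A 5 = A 6"
    have "W 5 n \<in> A 5" unfolding A_def using n3 by (intro subsetD[OF rspan_superset]) auto
    then have "coord (W 5 n) 5 = 0" using eq AT[of 6] by auto
    then show False using piv[of 5 n n] n3 by (simp add: p_def)
  qed
  have IntA: "A 5 \<inter> A 6 = F (n - 1)"
    using n3 dimF[of "n - 1"] FA[of "n - 1"] by (intro maxts_Int_eq maxA A56 subF) auto
  have no_rat: "coord u 1 = 0 \<and> coord u 4 = 0" if u: "u \<in> A s" "u \<in> ratvec" "s = 5 \<or> s = 6" for u s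
  proof -
    have eq: "coord u 3 = a * coord u 1" "coord u 2 = - (a * coord u 4)" using AT[OF u(3)] u(1) by auto
    have uK: "coord u i \<in> K" for i using u(2) by (simp add: ratvec_def)
    have *: "x = 0" if "x \<in> K" "a * x \<in> K" for x
    proof (rule ccontr)
      assume "x \<noteq> 0"
      then have "a = (a * x) * inverse x" by simp
      then show False using a sub_division_ringD(4,5)[OF sub_K] that by metis
    qed
    show ?thesis
      using *[of "coord u 1"] *[of "coord u 4"] uK[of 1] uK[of 4] uK[of 3]
        sub_division_ringD(6)[OF sub_K uK[of 2]] eq by simp
  qed
  have v: "W 5 1 \<in> F k" if "1 \<le> k" for k
    unfolding F_def using that by (intro subsetD[OF rspan_superset]) auto
  have cv: "coord (W 5 1) 1 = 1" using piv[of 5 1 1] n3 by (simp add: p_def)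
  define C where "C = F ` {1..n - 2} \<union> {A 5, A 6}"
  have elF: "F k \<in> elements G" "type_of G (F k) = Dim k" if "k \<in> {1..n - 2}" for k
    using that ts_subset[OF maxtsD(1)[OF maxA[of 5]] subF FA] dimF[of k] n3 type_of_small[of "F k"]
    by (auto simp: elements_iff)
  have elA: "A s \<in> elements G" if "s = 5 \<or> s = 6" for s using maxA[OF that] by (simp add: elements_iff)
  have dimI: "Suc (rdim scale (A 5 \<inter> A 6)) = n" using IntA dimF[of "n - 1"] n3 by simp
  \<comment> \<open>Which of the two carries the sign \<open>+\<close> is left open; adjacency alone
    shows that their types differ.\<close>
  have tA: "type_of G ` {A 5, A 6} = {Plus, Minus}"
    using opposite_types[OF maxA maxA dimI] type_of_maxts[OF maxA[of 5]] type_of_maxts[OF maxA[of 6]]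
    by (auto split: if_splits)
  show ?thesis
  proof (intro exI[of _ C] conjI ballI impI)
    show "flag G C"
      unfolding flag_def
    proof
      show "C \<subseteq> elements G" using elF elA by (auto simp: C_def)
      have 1: "incident G (F k) (F l)" if "k \<in> {1..n - 2}" "l \<in> {1..n - 2}" for k l
        using monoF[of k l] monoF[of l k] elF(2)[OF that(1)] elF(2)[OF that(2)]
        by (cases "k \<le> l") (auto simp: incident_subset)
      have 2: "incident G (F k) (A s)" "incident G (A s) (F k)" if "k \<in> {1..n - 2}" for k s
      proof -
        have "k < n" using that n3 by auto
        then show "incident G (F k) (A s)" "incident G (A s) (F k)"
          using FA[of k s] elF(2)[OF that(1)] by (simp_all add: incident_subset)
      qed
      have 3: "incident G (A 5) (A 6)" "incident G (A 6) (A 5)"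
        using incident_opposite[of "A 5" "A 6"] incident_opposite[of "A 6" "A 5"] dimI tA
        by (auto simp: Int_commute doubleton_eq_iff opposite_def)
      show "pairwise (incident G) C"
        unfolding pairwise_def C_def using 1 2 3 by blast
    qed
    have tF: "type_of G ` F ` {1..n - 2} = Dim ` {1..n - 2}"
      unfolding image_image using elF(2) by (intro image_cong) auto
    show "type_of G ` C = nodes G"
      unfolding C_def nodes_G image_Un tF tA ..
    have vA: "W 5 1 \<in> A s" for s using v[of 1] FA[of 1 s] n3 by auto
    have memv: "W 5 1 \<in> X" if "X \<in> C" for X
      using that v vA by (auto simp: C_def simp del: One_nat_def)
    have inA: "\<exists>s. (s = 5 \<or> s = 6) \<and> X \<subseteq> A s" if XC: "X \<in> C" for X
    proof -
      consider k where "k \<in> {1..n - 2}" "X = F k" | "X = A 5" | "X = A 6"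
        using XC unfolding C_def by blast
      then show ?thesis
      proof cases
        case 1
        then have "k < n" using n3 by auto
        then show ?thesis using 1 FA[of k 5] by blast
      qed blast+
    qed
    show nb: "\<not> between X Y" if "X \<in> C" "Y \<in> C" for X Y
    proof -
      obtain s where "s = 5 \<or> s = 6" "Y \<subseteq> A s" using inA[OF \<open>Y \<in> C\<close>] by blast
      then show ?thesis
        using not_between[OF memv[OF \<open>X \<in> C\<close>], of 1 Y] cv no_rat[of _ s] by auto
    qed
    show "\<not> linked X Y" if XY: "X \<in> C" "Y \<in> C" "type_of G X = Plus" "type_of G Y = Minus" for X Y
    proof
      assume "linked X Y"
      \<comment> \<open>A rational \<open>X\<close> would itself be a rational subspace between
        \<open>X\<close> and \<open>X\<close>.\<close>
      moreover have "\<not> rat X" "\<not> rat Y"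
        using nb[OF XY(1,1)] nb[OF XY(2,2)] by (auto simp: between_def)
      ultimately obtain Z where Z: "rat Z" "Z \<subseteq> X \<inter> Y" "n \<le> rdim scale Z + 2"
        by (auto simp: linked_def)
      have "X \<in> {A 5, A 6}" "Y \<in> {A 5, A 6}" using XY elF(2) by (auto simp: C_def)
      moreover have "X \<noteq> Y" using XY by auto
      ultimately have ZF: "Z \<subseteq> F (n - 1)" "Z \<subseteq> A 5" using Z(2) IntA by auto
      have "rsubspace scale {u. coord u 1 = 0 \<and> coord u 4 = 0}"
        by (auto simp: rsubspace_def coords_add coords_scale)
      then have "rspan (Z \<inter> ratvec) \<subseteq> {u. coord u 1 = 0 \<and> coord u 4 = 0}"
        by (rule rspan_least) (use ZF no_rat[of _ 5] in auto)
      then have Z14: "coord u 1 = 0" "coord u 4 = 0" if "u \<in> Z" for u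
        using ratD(2)[OF Z(1)] that by auto
      \<comment> \<open>Coordinates 1 and 4 are the pivots of the plane \<open>F 2\<close> and
        vanish on \<open>Z\<close>. So \<open>Z\<close> meets the plane trivially inside
        \<open>F (n - 1)\<close>, which leaves it at most \<open>n - 3\<close> dimensions.\<close>
      have "u = 0" if u: "u \<in> Z \<inter> F 2" for u
      proof -
        have "{1..2} = {1::nat, 2}" by auto
        then have "u \<in> rspan (insert (W 5 1) {W 5 2})" using u by (simp add: F_def)
        then obtain c d where "u - scale (W 5 1) c = scale (W 5 2) d"
          by (auto simp: rspan_insert rspan_singleton)
        then have ucd: "u = scale (W 5 1) c + scale (W 5 2) d" by (simp add: algebra_simps)
        have "coord u 1 = c" "coord u 4 = d"
          using piv[of 5 1 1] piv[of 5 1 2] piv[of 5 2 1] piv[of 5 2 2] n3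
          by (simp_all add: ucd coords_add coords_scale p_def)
        then show ?thesis using Z14[of u] u ucd by simp
      qed
      then have "Z \<inter> F 2 = {0}" using rsubspaceD(1)[OF ratD(1)[OF Z(1)]] rsubspaceD(1)[OF subF] by blast
      then have "rdim scale (Z + F 2) = rdim scale Z + 2"
        using rdim_plus_Int[OF ratD(1)[OF Z(1)] subF, of 2] dimF[of 2] n3 by (simp add: rdim_zero)
      moreover have "rdim scale (Z + F 2) \<le> n - 1"
        using rdim_mono[OF rsubspace_plus[OF ratD(1)[OF Z(1)] subF[of 2]] subF[of "n - 1"]]
          plus_least[OF subF ZF(1) monoF[of 2 "n - 1"]] dimF[of "n - 1"] n3 by simp
      ultimately show False using Z(3) n3 by simp
    qed
  qed
qed

text \<open>Treats every pair with at least one ordinary type, the smaller dimension being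
  \<open>i\<close>, so that inclusion describes the incidence of the two members.\<close>

lemma not_generated_Dim:
  assumes "K \<noteq> UNIV" "J \<subseteq> nodes G" "Dim i \<in> J" "t \<in> J"
    and t: "\<And>k. t = Dim k \<Longrightarrow> i < k"
  shows "\<not> rationally_generated scale (2 * n) E K (Gr G J)"
proof -
  obtain a where a: "a \<notin> K" using assms(1) by blast
  obtain C where C: "flag G C" "type_of G ` C = nodes G"
    and *: "\<forall>X\<in>C. \<forall>Y\<in>C. \<not> between X Y \<and>
      (type_of G X = Plus \<longrightarrow> type_of G Y = Minus \<longrightarrow> \<not> linked X Y)"
    using ex_chamber[OF a] by (elim exE conjE)
  have i: "1 \<le> i" "i \<le> n - 2" using assms(2,3) by (auto simp: nodes_G)
  have rdim_t: "i < rdim scale Y" if "Y \<in> elements G" "type_of G Y = t" for Y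
  proof (cases t)
    case (Dim k)
    then show ?thesis using type_of_DimD(3)[OF that(1)] that(2) t by simp
  qed (use type_of_signD[OF that(1)] that(2) maxtsD(3) i n3 in auto)
  obtain X0 Y0 where XY0: "X0 \<in> C" "Y0 \<in> C" "type_of G X0 = Dim i" "type_of G Y0 = t"
  proof -
    have "Dim i \<in> type_of G ` C" "t \<in> type_of G ` C" using C(2) assms(2-4) by auto
    then show ?thesis using that by (elim imageE) metis
  qed
  show ?thesis
  proof (rule not_rationally_generatedI[where s = "Dim i" and t = t and R = between
        and C = C and ?X0.0 = X0 and ?Y0.0 = Y0])
    show "Dim i \<in> J" "t \<in> J" "flag G C" "X0 \<in> C" "Y0 \<in> C" "type_of G X0 = Dim i" "type_of G Y0 = t"
      using assms C XY0 by auto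
    show "Dim i \<noteq> t" using t by blast
    show "J \<subseteq> type_of G ` C" using C(2) assms(2) by simp
    show "\<not> between X0 Y0" using * XY0(1,2) by simp
    show "incident G X X" for X by (rule incident_refl)
    show "X = Y" if "X \<in> elements G" "Y \<in> elements G" "incident G X Y" "type_of G X = type_of G Y" for X Y
      using incident_same_type that by blast
    show "between X Y" if "X \<in> elements G" "Y \<in> elements G" "type_of G X = Dim i" "type_of G Y = t"
      "incident G X Y" "rational_subspace scale (2 * n) E K X" for X Y
      using between_rational[OF that(6)] incident_below[OF that(1,2) _ that(3)] that(5) rdim_t[OF that(2,4)]
      by simp
  next
    fix X1 X2 X Y
    assume el: "{X1, X2, X, Y} \<subseteq> elements G" and ty: "type_of G ` {X1, X2, X} = {Dim i}" "type_of G Y = t"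
      and ne: "X1 \<noteq> X2" and inc: "\<forall>Z\<in>{X1, X2, X}. incident G Z Y"
      and L: "\<And>j. j \<in> fr G (Dim i) \<Longrightarrow>
        \<exists>L\<in>elements G. type_of G L = j \<and> (\<forall>Z\<in>{X1, X2, X, Y}. incident G L Z)"
      and bt: "between X1 Y" "between X2 Y"
    have X: "Z \<in> elements G" "type_of G Z = Dim i" if "Z \<in> {X1, X2, X}" for Z using that el ty by auto
    have dX: "rdim scale X1 = i" "rdim scale X2 = i" and sX: "rsubspace scale X1" "rsubspace scale X2"
      using type_of_DimD[OF X] by auto
    have sY: "Y \<in> elements G" "rsubspace scale Y" using el elements_rsubspace by auto
    have "\<exists>L. rsubspace scale L \<and> rdim scale L = i + 1 \<and> X1 \<subseteq> L \<and> X2 \<subseteq> L \<and> X \<subseteq> L"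
    proof (cases "i < n - 2")
      case True
      then obtain L where L: "L \<in> elements G" "type_of G L = Dim (i + 1)" "\<forall>Z\<in>{X1, X2, X, Y}. incident G L Z"
        using L fr_Dim(1) i by blast
      have dL: "rsubspace scale L" "rdim scale L = i + 1" using type_of_DimD[OF L(1,2)] by auto
      have "Z \<subseteq> L" if "Z \<in> {X1, X2, X}" for Z
        using incident_below[OF X(1)[OF that] L(1) _ X(2)[OF that]] L(3) that dL by auto
      then show ?thesis using dL by blast
    next
      case False
      then have i: "i = n - 2" using i by simp
      \<comment> \<open>No element has dimension \<open>n - 1\<close>. Here \<open>Y\<close> is
        maximal, and the line also contains a maximal subspace of the other sign \<open>T\<close>;
        its intersection with \<open>Y\<close> has the missing dimension and contains all
        positions.\<close>
      obtain T where T: "t = Plus \<and> T = Minus \<or> t = Minus \<and> T = Plus"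
        using rdim_t[OF sY(1) ty(2)] type_of_DimD(3,5)[OF sY(1)] ty(2) i by (cases t) auto
      then obtain L where L: "L \<in> elements G" "type_of G L = T" "\<forall>Z\<in>{X1, X2, X, Y}. incident G L Z"
        using L fr_Dim(3,4) i by metis
      have mL: "L \<in> maxts" using type_of_signD[OF L(1)] L(2) T by auto
      have mY: "Y \<in> maxts" using type_of_signD[OF sY(1)] ty(2) T by auto
      have "Suc (rdim scale (L \<inter> Y)) = n"
        using incident_opposite[of L Y] L(2,3) ty(2) T by (auto simp: opposite_def)
      then have d: "rdim scale (L \<inter> Y) = i + 1" using i n3 by simp
      have "Z \<subseteq> L \<inter> Y" if "Z \<in> {X1, X2, X}" for Z
        using incident_below[OF X(1)[OF that] L(1) _ X(2)[OF that]]
          incident_below[OF X(1)[OF that] sY(1) _ X(2)[OF that]] L(3) inc that maxtsD(3)[OF mL] maxtsD(3)[OF mY] i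
        by auto
      then show ?thesis using d rsubspace_Int[OF maxtsD(2)[OF mL] sY(2)] by blast
    qed
    then obtain L where "rsubspace scale L" "rdim scale L = i + 1" "X1 \<subseteq> L" "X2 \<subseteq> L" "X \<subseteq> L" by blast
    then show "between X Y"
      using between_lower[OF sX _ sY(2) ne _ _ _ _ _ bt] dX by simp
  next
    fix Y1 Y2 Y X
    assume el: "{Y1, Y2, Y, X} \<subseteq> elements G" and ty: "type_of G ` {Y1, Y2, Y} = {t}" "type_of G X = Dim i"
      and ne: "Y1 \<noteq> Y2"
      and L: "\<And>j. j \<in> fr G t \<Longrightarrow>
        \<exists>L\<in>elements G. type_of G L = j \<and> (\<forall>Z\<in>{Y1, Y2, Y, X}. incident G L Z)"
      and bt: "between X Y1" "between X Y2"
    have Y: "Z \<in> elements G" "type_of G Z = t" if "Z \<in> {Y1, Y2, Y}" for Z using that el ty by auto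
    have sY: "rsubspace scale Y1" "rsubspace scale Y2" using Y(1) elements_rsubspace by auto
    \<comment> \<open>The line supplies the subspace needed as intersection: dimension
      \<open>k - 1\<close> under members of dimension \<open>k\<close>, but \<open>n - 2\<close>
      under maximal ones, since distinct members of one class meet in codimension at least
      two.\<close>
    have "\<exists>L k. L \<in> elements G \<and> type_of G L = Dim k \<and> rdim scale (Y1 \<inter> Y2) \<le> k \<and>
      (\<forall>Z\<in>{Y1, Y2, Y}. k \<le> rdim scale Z \<and> incident G L Z)"
    proof (cases t)
      case (Dim k)
      have dY: "rdim scale Z = k" if "Z \<in> {Y1, Y2, Y}" for Z
        using type_of_DimD(3)[OF Y(1)[OF that]] Y(2)[OF that] Dim by simp
      have "1 < k" "k \<le> n - 2" using t[OF Dim] i type_of_DimD(5)[OF Y(1)] Y(2) Dim by auto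
      then obtain L where "L \<in> elements G" "type_of G L = Dim (k - 1)" "\<forall>Z\<in>{Y1, Y2, Y, X}. incident G L Z"
        using L fr_Dim(2) Dim by blast
      moreover have "rdim scale (Y1 \<inter> Y2) < k" using rdim_Int_less[OF sY ne] dY by simp
      ultimately show ?thesis using dY by (intro exI[of _ L] exI[of _ "k - 1"]) auto
    next
      case Plus
      have mY: "Z \<in> maxts" if "Z \<in> {Y1, Y2, Y}" for Z using type_of_signD[OF Y(1)] Y(2) Plus that by auto
      obtain L where "L \<in> elements G" "type_of G L = Dim (n - 2)" "\<forall>Z\<in>{Y1, Y2, Y, X}. incident G L Z"
        using L fr_Dim(5) Plus by blast
      moreover have "rdim scale (Y1 \<inter> Y2) + 2 \<le> n"
        using same_type_Int[OF mY mY] Y(2) ne by simp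
      ultimately show ?thesis using mY maxtsD(3) by (intro exI[of _ L] exI[of _ "n - 2"]) auto
    next
      case Minus
      have mY: "Z \<in> maxts" if "Z \<in> {Y1, Y2, Y}" for Z using type_of_signD[OF Y(1)] Y(2) Minus that by auto
      obtain L where "L \<in> elements G" "type_of G L = Dim (n - 2)" "\<forall>Z\<in>{Y1, Y2, Y, X}. incident G L Z"
        using L fr_Dim(6) Minus by blast
      moreover have "rdim scale (Y1 \<inter> Y2) + 2 \<le> n"
        using same_type_Int[OF mY mY] Y(2) ne by simp
      ultimately show ?thesis using mY maxtsD(3) by (intro exI[of _ L] exI[of _ "n - 2"]) auto
    qed
    then obtain L k where L: "L \<in> elements G" "type_of G L = Dim k" "rdim scale (Y1 \<inter> Y2) \<le> k"
      "\<forall>Z\<in>{Y1, Y2, Y}. k \<le> rdim scale Z \<and> incident G L Z" by blast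
    have "L \<subseteq> Z" if "Z \<in> {Y1, Y2, Y}" for Z
      using incident_below[OF L(1) Y(1)[OF that] _ L(2)] L(4) that by blast
    then show "between X Y"
      using between_upper[OF sY elements_rsubspace[OF L(1)] _ _ _ _ bt] L(3) type_of_DimD(3)[OF L(1,2)]
      by simp
  qed
qed

text \<open>Leaving the sign \<open>T\<close> open serves both kinds of lines, as
  \<open>linked\<close> is symmetric. The exact dimension \<open>n - 2\<close> of
  \<open>X1 \<inter> X2\<close> comes from the class on one side and from \<open>L\<close> on the
  other.\<close>

lemma linked_line_type:
  assumes el: "{X1, X2, X, Y} \<subseteq> elements G"
    and ty: "type_of G ` {X1, X2, X} = {T}" "opposite T (type_of G Y)"
    and ne: "X1 \<noteq> X2" and inc: "\<forall>Z\<in>{X1, X2, X}. incident G Z Y"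
    and L: "L \<in> elements G" "type_of G L = Dim (n - 2)" "\<forall>Z\<in>{X1, X2, X, Y}. incident G L Z"
    and "linked X1 Y" "linked X2 Y"
  shows "linked X Y"
proof -
  have X: "Z \<in> elements G" "type_of G Z = T" if "Z \<in> {X1, X2, X}" for Z using that el ty by auto
  have max: "Z \<in> maxts" if "Z \<in> {X1, X2, X, Y}" for Z
    using that type_of_signD[of Z] X[of Z] ty(2) el by (auto simp: opposite_def)
  have adj: "Suc (rdim scale (Z \<inter> Y)) = n" if "Z \<in> {X1, X2, X}" for Z
    using incident_opposite[of Z Y] X(2)[OF that] ty(2) inc that by auto
  have dL: "rsubspace scale L" "rdim scale L + 2 = n" using type_of_DimD[OF L(1,2)] n3 by auto
  have sL: "L \<subseteq> Z" if "Z \<in> {X1, X2, X, Y}" for Z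
    using incident_below[OF L(1) _ _ L(2), of Z] that L(3) el maxtsD(3)[OF max[OF that]] by auto
  have "rdim scale (X1 \<inter> X2) + 2 \<le> n"
    using same_type_Int[OF max max] X(2) ne by simp
  moreover have "rdim scale L \<le> rdim scale (X1 \<inter> X2)"
    using sL by (intro rdim_mono dL rsubspace_Int maxtsD(2) max) auto
  ultimately have "rdim scale (X1 \<inter> X2) + 2 = n" using dL by simp
  then show ?thesis
    using linked_line[of X1 X2 Y L X] max adj dL sL assms by simp
qed

lemma not_generated_signs:
  assumes "K \<noteq> UNIV" "J \<subseteq> nodes G" "Plus \<in> J" "Minus \<in> J"
  shows "\<not> rationally_generated scale (2 * n) E K (Gr G J)"
proof -
  obtain a where a: "a \<notin> K" using assms(1) by blast
  obtain C where C: "flag G C" "type_of G ` C = nodes G"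
    and *: "\<forall>X\<in>C. \<forall>Y\<in>C. \<not> between X Y \<and>
      (type_of G X = Plus \<longrightarrow> type_of G Y = Minus \<longrightarrow> \<not> linked X Y)"
    using ex_chamber[OF a] by (elim exE conjE)
  obtain X0 Y0 where XY0: "X0 \<in> C" "Y0 \<in> C" "type_of G X0 = Plus" "type_of G Y0 = Minus"
  proof -
    have "Plus \<in> type_of G ` C" "Minus \<in> type_of G ` C" using C(2) assms(2-4) by auto
    then show ?thesis using that by (elim imageE) metis
  qed
  show ?thesis
  proof (rule not_rationally_generatedI[where s = Plus and t = Minus and R = linked
        and C = C and ?X0.0 = X0 and ?Y0.0 = Y0])
    show "Plus \<in> J" "Minus \<in> J" "Plus \<noteq> Minus" "flag G C" "X0 \<in> C" "Y0 \<in> C"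
      "type_of G X0 = Plus" "type_of G Y0 = Minus"
      using assms C XY0 by auto
    show "J \<subseteq> type_of G ` C" using C(2) assms(2) by simp
    show "\<not> linked X0 Y0" using * XY0 by simp
    show "incident G X X" for X by (rule incident_refl)
    show "X = Y" if "X \<in> elements G" "Y \<in> elements G" "incident G X Y" "type_of G X = type_of G Y" for X Y
      using incident_same_type that by blast
    show "linked X Y" if "rational_subspace scale (2 * n) E K X" for X Y
      using rational_subspace_rat[OF that] by (simp add: linked_def)
  next
    fix X1 X2 X Y
    assume *: "{X1, X2, X, Y} \<subseteq> elements G" "type_of G ` {X1, X2, X} = {Plus}" "type_of G Y = Minus"
      "X1 \<noteq> X2" "\<forall>Z\<in>{X1, X2, X}. incident G Z Y"
      and L: "\<And>j. j \<in> fr G Plus \<Longrightarrow>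
        \<exists>L\<in>elements G. type_of G L = j \<and> (\<forall>Z\<in>{X1, X2, X, Y}. incident G L Z)"
      and R: "linked X1 Y" "linked X2 Y"
    obtain L where "L \<in> elements G" "type_of G L = Dim (n - 2)" "\<forall>Z\<in>{X1, X2, X, Y}. incident G L Z"
      using L[OF fr_Dim(5)] by blast
    then show "linked X Y" using linked_line_type[OF *(1,2) _ *(4,5)] R *(3) by (simp add: opposite_def)
  next
    fix Y1 Y2 Y X
    assume *: "{Y1, Y2, Y, X} \<subseteq> elements G" "type_of G ` {Y1, Y2, Y} = {Minus}" "type_of G X = Plus"
      "Y1 \<noteq> Y2" "\<forall>Z\<in>{Y1, Y2, Y}. incident G X Z"
      and L: "\<And>j. j \<in> fr G Minus \<Longrightarrow>
        \<exists>L\<in>elements G. type_of G L = j \<and> (\<forall>Z\<in>{Y1, Y2, Y, X}. incident G L Z)"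
      and R: "linked X Y1" "linked X Y2"
    have inc: "\<forall>Z\<in>{Y1, Y2, Y}. incident G Z X"
    proof
      fix Z assume Z: "Z \<in> {Y1, Y2, Y}"
      then have "Z \<in> elements G" "type_of G Z = Minus" "X \<in> elements G" "incident G X Z" using * by auto
      then show "incident G Z X"
        using incident_opposite[of Z X] incident_opposite[of X Z] *(3)
        by (simp add: Int_commute opposite_def)
    qed
    obtain L where "L \<in> elements G" "type_of G L = Dim (n - 2)" "\<forall>Z\<in>{Y1, Y2, Y, X}. incident G L Z"
      using L[OF fr_Dim(6)] by blast
    moreover have "linked Y1 X" "linked Y2 X" using R linked_commute by auto
    ultimately have "linked Y X"
      using linked_line_type[OF *(1,2) _ *(4) inc] *(3) by (simp add: opposite_def)
    then show "linked X Y" using linked_commute by simp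
  qed
qed

lemma D_not_generated:
  assumes "K \<noteq> UNIV" "J \<subseteq> nodes G" "s \<in> J" "t \<in> J" "s \<noteq> t"
  shows "\<not> rationally_generated scale (2 * n) E K (Gr G J)"
proof -
  consider i k where "{s, t} = {Dim i, Dim k}" "i < k"
    | i u where "{s, t} = {Dim i, u}" "u = Plus \<or> u = Minus"
    | "{s, t} = {Plus, Minus}"
    using assms(5) by (cases s; cases t) (auto, metis insert_commute linorder_neqE_nat)
  then show ?thesis
  proof cases
    case 1
    then have "Dim i \<in> J" "Dim k \<in> J" using assms by (metis insert_subset empty_subsetI)+
    then show ?thesis using not_generated_Dim[OF assms(1,2), of i "Dim k"] 1 by simp
  next
    case 2
    then have "Dim i \<in> J" "u \<in> J" using assms by (metis insert_subset empty_subsetI)+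
    then show ?thesis using not_generated_Dim[OF assms(1,2), of i u] 2 by auto
  next
    case 3
    then have "Plus \<in> J" "Minus \<in> J" using assms by (metis insert_subset empty_subsetI)+
    then show ?thesis using not_generated_signs[OF assms(1,2)] by simp
  qed
qed

end

theorem theorem1p3:
  shows "(\<forall>(scale :: 'v::ab_group_add \<Rightarrow> 'k::division_ring \<Rightarrow> 'v) n E J K0.
            n \<ge> 1 \<and> based_right_vector_space scale (n + 1) E
            \<and> J \<subseteq> nodes (A_building scale n) \<and> \<not> connected_nodes (A_building scale n) J
            \<and> sub_division_ring K0 \<and> K0 \<noteq> UNIV
            \<longrightarrow> \<not> rationally_generated scale (n + 1) E K0 (Gr (A_building scale n) J))
       \<and> (\<forall>(scale :: 'w::ab_group_add \<Rightarrow> 'f::field \<Rightarrow> 'w) n E J K0.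
            n \<ge> 3 \<and> based_right_vector_space scale (2 * n) E
            \<and> J \<subseteq> nodes (D_building scale n E) \<and> \<not> connected_nodes (D_building scale n E) J
            \<and> sub_division_ring K0 \<and> K0 \<noteq> UNIV
            \<longrightarrow> \<not> rationally_generated scale (2 * n) E K0 (Gr (D_building scale n E) J))"
proof (intro conjI allI impI)
  fix scale :: "'v::ab_group_add \<Rightarrow> 'k::division_ring \<Rightarrow> 'v" and n E J and K0 :: "'k set"
  assume *: "n \<ge> 1 \<and> based_right_vector_space scale (n + 1) E
    \<and> J \<subseteq> nodes (A_building scale n) \<and> \<not> connected_nodes (A_building scale n) J
    \<and> sub_division_ring K0 \<and> K0 \<noteq> UNIV"
  then have "rational_structure scale (n + 1) E K0"
    by (simp add: rational_structure_def rational_structure_axioms_def)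
  moreover obtain s t where "s \<in> J" "t \<in> J" "s \<noteq> t" using * not_connected_nodesE by blast
  then obtain s t where "s \<in> J" "t \<in> J" "s < t" by (metis linorder_neqE_nat)
  moreover have "J \<subseteq> {1..n}" using * by (simp add: A_building_def)
  ultimately show "\<not> rationally_generated scale (n + 1) E K0 (Gr (A_building scale n) J)"
    using * A_not_generated[of scale "n + 1" E K0 n J s t] by simp
next
  fix scale :: "'w::ab_group_add \<Rightarrow> 'f::field \<Rightarrow> 'w" and n E J and K0 :: "'f set"
  assume *: "n \<ge> 3 \<and> based_right_vector_space scale (2 * n) E
    \<and> J \<subseteq> nodes (D_building scale n E) \<and> \<not> connected_nodes (D_building scale n E) J
    \<and> sub_division_ring K0 \<and> K0 \<noteq> UNIV"
  then have "D_space scale n E K0"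
    by (simp add: D_space_def D_space_axioms_def hyperbolic_space_def rational_structure_def
        rational_structure_axioms_def)
  moreover obtain s t where "s \<in> J" "t \<in> J" "s \<noteq> t" using * not_connected_nodesE by blast
  ultimately show "\<not> rationally_generated scale (2 * n) E K0 (Gr (D_building scale n E) J)"
    using * D_space.D_not_generated[of scale n E K0 J s t] by simp
qed

end
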